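(* Let $C$ be a kernel configuration. A model $(\mathbb V,\theta)\models T^C_{K\text{-vs},\theta}$ is existentially closed if and only if it is $C$-complete.
   Context: $K$ is a field, $T_{K\text{-vs}}$ is the theory of infinite $K$-vector spaces in the language $\{0,+,(\lambda\cdot)_{\lambda\in K}\}$. For an endomorphism $\theta$ of a $K$-vector space $\mathbb V$ and $\rho=\sum_i\rho_iX^i\in K[X]$ put $\rho[\theta]=\sum_i\rho_i\theta^i$. **Kernel configurations.** $K[X]_{\mathrm{irr}}$ is the set of monic irreducible polynomials over $K$. A kernel configuration is a pair $C=(c,d)$ with $c:K[X]_{\mathrm{irr}}\to\mathbb N\cup\{\infty\}$ a function and $d\in\mathbb N_{>0}\cup\{\infty\}$ either equal to $\infty$ or equal to $\sum_f\deg(f)c(f)$. Write $C(f)=c(f)$, $\deg(C)=d$. $C$ is algebraic if $d<\infty$, and then $\operatorname{MiPo}(C)=\prod_f f^{C(f)}$; $C$ is transcendental if $d=\infty$. An endomorphism $\theta$ of $\mathbb V$ is a $C$-endomorphism if: $\operatorname{MiPo}(C)[\theta]=0$ (when $C$ is algebraic); $\operatorname{Ker}(f^{C(f)}[\theta])=\operatorname{Ker}(f^{C(f)+1}[\theta])$ for all $f\in K[X]_{\mathrm{irr}}$ with $C(f)<\infty$ (when $C$ is transcendental). $T^C_{K\text{-vs},\theta}$ is the theory, in the language of $K$-vector spaces with an additional unary function symbol $\theta$, of infinite $K$-vector spaces with a $C$-endomorphism $\theta$. **$C$-completeness.** An endomorphism $\theta$ of $\mathbb V$ (or the model $(\mathbb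 V,\theta)$) is $C$-complete if all of the following hold: (i) $\theta$ is a $C$-endomorphism and $\operatorname{Im}(f^{C(f)}[\theta])=\operatorname{Im}(f^{C(f)+1}[\theta])$ for all $f\in K[X]_{\mathrm{irr}}$ with $C(f)<\infty$; (ii) for every $f\in K[X]_{\mathrm{irr}}$ with $0<C(f)<\infty$ and every $u\in\operatorname{Ker}(f^{C(f)-1}[\theta])$, the set $\{x\in\mathbb V:f[\theta](x)=u\}$ is infinite; (iii) for every $f\in K[X]_{\mathrm{irr}}$ with $C(f)=\infty$ and every $u\in\mathbb V$, the set $\{x\in\mathbb V:f[\theta](x)=u\}$ is infinite; (iv) if $C$ is transcendental, then the partial type expressing that $(\theta^i(x):i\in\omega)$ is $K$-linearly independent over $\mathbb V$, i.e. $\{\rho[\theta](x)\neq u:\rho\in K[X]\setminus\{0\},\,u\in\mathbb V\}$, is finitely satisfiable in $(\mathbb V,\theta)$. *)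

theory Defs
  imports
    "HOL-Computational_Algebra.Computational_Algebra"
    "HOL-Library.Extended_Nat"
    "HOL-Library.Equipollence"
begin

section \<open>Kernel configurations\<close>

definition monic_irreducibles :: "'k::field poly set" where
  "monic_irreducibles = {f. irreducible f \<and> lead_coeff f = 1}"

text \<open>A pair \<open>(c, d)\<close>; only the values of \<open>c\<close> on \<^const>\<open>monic_irreducibles\<close> are ever used.\<close>

type_synonym 'k kconf = "('k poly \<Rightarrow> enat) \<times> enat"

definition kconf_support :: "'k::field kconf \<Rightarrow> 'k poly set" where
  "kconf_support C = {f \<in> monic_irreducibles. fst C f \<noteq> 0}"

text \<open>If the support is infinite, the sum of all \<open>deg(f) c(f)\<close> is infinite, so that
  \<open>d = \<infinity>\<close> is the only possibility; the finite sum is therefore only needed for finite support.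
  It takes the value \<open>\<infinity>\<close> as soon as some \<open>c(f)\<close> does.\<close>

definition kernel_configuration :: "'k::field kconf \<Rightarrow> bool" where
  "kernel_configuration C \<longleftrightarrow>
     snd C \<noteq> 0 \<and>
     (snd C = \<infinity> \<or>
      finite (kconf_support C) \<and>
      snd C = (\<Sum>f\<in>kconf_support C. enat (degree f) * fst C f))"

definition algebraic :: "'k::field kconf \<Rightarrow> bool" where
  "algebraic C \<longleftrightarrow> snd C < \<infinity>"

definition transcendental :: "'k::field kconf \<Rightarrow> bool" where
  "transcendental C \<longleftrightarrow> snd C = \<infinity>"

definition MiPo :: "'k::field kconf \<Rightarrow> 'k poly" where
  "MiPo C = (\<Prod>f\<in>kconf_support C. f ^ the_enat (fst C f))"


section \<open>Endomorphisms and \<open>C\<close>-endomorphisms\<close>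

text \<open>Throughout, a structure is given by a scalar multiplication \<open>scale\<close> on an ambient abelian
  group, a carrier \<open>V\<close> that is a linear subspace (possibly everything), and a map \<open>\<theta>\<close> of which
  only the restriction to \<open>V\<close> matters. Explicit carriers make it possible to quantify over
  extensions inside a formula.\<close>

definition endomorphism_on ::
    "('k::field \<Rightarrow> 'v::ab_group_add \<Rightarrow> 'v) \<Rightarrow> 'v set \<Rightarrow> ('v \<Rightarrow> 'v) \<Rightarrow> bool" where
  "endomorphism_on scale V \<theta> \<longleftrightarrow>
     (\<forall>x\<in>V. \<theta> x \<in> V) \<and>
     (\<forall>x\<in>V. \<forall>y\<in>V. \<theta> (x + y) = \<theta> x + \<theta> y) \<and>
     (\<forall>a. \<forall>x\<in>V. \<theta> (scale a x) = scale a (\<theta> x))"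

definition poly_endo ::
    "('k::field \<Rightarrow> 'v::ab_group_add \<Rightarrow> 'v) \<Rightarrow> 'k poly \<Rightarrow> ('v \<Rightarrow> 'v) \<Rightarrow> 'v \<Rightarrow> 'v" where
  "poly_endo scale \<rho> \<theta> x = (\<Sum>i\<le>degree \<rho>. scale (coeff \<rho> i) ((\<theta> ^^ i) x))"

definition Ker_on ::
    "('k::field \<Rightarrow> 'v::ab_group_add \<Rightarrow> 'v) \<Rightarrow> 'v set \<Rightarrow> ('v \<Rightarrow> 'v) \<Rightarrow> 'k poly \<Rightarrow> 'v set" where
  "Ker_on scale V \<theta> \<rho> = {x \<in> V. poly_endo scale \<rho> \<theta> x = 0}"

definition Im_on ::
    "('k::field \<Rightarrow> 'v::ab_group_add \<Rightarrow> 'v) \<Rightarrow> 'v set \<Rightarrow> ('v \<Rightarrow> 'v) \<Rightarrow> 'k poly \<Rightarrow> 'v set" where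
  "Im_on scale V \<theta> \<rho> = poly_endo scale \<rho> \<theta> ` V"

definition C_endomorphism ::
    "'k::field kconf \<Rightarrow> ('k \<Rightarrow> 'v::ab_group_add \<Rightarrow> 'v) \<Rightarrow> 'v set \<Rightarrow> ('v \<Rightarrow> 'v) \<Rightarrow> bool" where
  "C_endomorphism C scale V \<theta> \<longleftrightarrow>
     endomorphism_on scale V \<theta> \<and>
     (algebraic C \<longrightarrow> (\<forall>x\<in>V. poly_endo scale (MiPo C) \<theta> x = 0)) \<and>
     (transcendental C \<longrightarrow>
       (\<forall>f\<in>monic_irreducibles. fst C f < \<infinity> \<longrightarrow>
          Ker_on scale V \<theta> (f ^ the_enat (fst C f)) =
          Ker_on scale V \<theta> (f ^ (the_enat (fst C f) + 1))))"

text \<open>\<open>(V, \<theta>)\<close> is a model of the theory of infinite \<open>K\<close>-vector spaces with a \<open>C\<close>-endomorphism.\<close>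

definition models_T ::
    "'k::field kconf \<Rightarrow> ('k \<Rightarrow> 'v::ab_group_add \<Rightarrow> 'v) \<Rightarrow> 'v set \<Rightarrow> ('v \<Rightarrow> 'v) \<Rightarrow> bool" where
  "models_T C scale V \<theta> \<longleftrightarrow>
     vector_space scale \<and> module.subspace scale V \<and> infinite V \<and> C_endomorphism C scale V \<theta>"


section \<open>\<open>C\<close>-completeness\<close>

definition C_complete ::
    "'k::field kconf \<Rightarrow> ('k \<Rightarrow> 'v::ab_group_add \<Rightarrow> 'v) \<Rightarrow> 'v set \<Rightarrow> ('v \<Rightarrow> 'v) \<Rightarrow> bool" where
  "C_complete C scale V \<theta> \<longleftrightarrow>
     C_endomorphism C scale V \<theta> \<and>
     (\<forall>f\<in>monic_irreducibles. fst C f < \<infinity> \<longrightarrow>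
        Im_on scale V \<theta> (f ^ the_enat (fst C f)) =
        Im_on scale V \<theta> (f ^ (the_enat (fst C f) + 1))) \<and>
     (\<forall>f\<in>monic_irreducibles. 0 < fst C f \<and> fst C f < \<infinity> \<longrightarrow>
        (\<forall>u\<in>Ker_on scale V \<theta> (f ^ (the_enat (fst C f) - 1)).
           infinite {x \<in> V. poly_endo scale f \<theta> x = u})) \<and>
     (\<forall>f\<in>monic_irreducibles. fst C f = \<infinity> \<longrightarrow>
        (\<forall>u\<in>V. infinite {x \<in> V. poly_endo scale f \<theta> x = u})) \<and>
     (transcendental C \<longrightarrow>
        (\<forall>F. finite F \<and> F \<subseteq> {(\<rho>, u). \<rho> \<noteq> 0 \<and> u \<in> V} \<longrightarrow>
           (\<exists>x\<in>V. \<forall>(\<rho>, u)\<in>F. poly_endo scale \<rho> \<theta> x \<noteq> u)))"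


section \<open>First-order formulas and existential closedness\<close>

datatype 'k tm =
    Var nat
  | Zero
  | Add "'k tm" "'k tm"
  | Smult 'k "'k tm"
  | Theta "'k tm"

datatype 'k fm =
    Equal "'k tm" "'k tm"
  | Neg "'k fm"
  | Conj "'k fm" "'k fm"
  | Exi nat "'k fm"

primrec tm_val ::
    "('k \<Rightarrow> 'v::ab_group_add \<Rightarrow> 'v) \<Rightarrow> ('v \<Rightarrow> 'v) \<Rightarrow> (nat \<Rightarrow> 'v) \<Rightarrow> 'k tm \<Rightarrow> 'v" where
  "tm_val scale \<theta> e (Var i) = e i"
| "tm_val scale \<theta> e Zero = 0"
| "tm_val scale \<theta> e (Add s t) = tm_val scale \<theta> e s + tm_val scale \<theta> e t"
| "tm_val scale \<theta> e (Smult a t) = scale a (tm_val scale \<theta> e t)"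
| "tm_val scale \<theta> e (Theta t) = \<theta> (tm_val scale \<theta> e t)"

primrec sat ::
    "('k \<Rightarrow> 'v::ab_group_add \<Rightarrow> 'v) \<Rightarrow> 'v set \<Rightarrow> ('v \<Rightarrow> 'v) \<Rightarrow> (nat \<Rightarrow> 'v) \<Rightarrow> 'k fm \<Rightarrow> bool" where
  "sat scale V \<theta> e (Equal s t) \<longleftrightarrow> tm_val scale \<theta> e s = tm_val scale \<theta> e t"
| "sat scale V \<theta> e (Neg \<phi>) \<longleftrightarrow> \<not> sat scale V \<theta> e \<phi>"
| "sat scale V \<theta> e (Conj \<phi> \<psi>) \<longleftrightarrow> sat scale V \<theta> e \<phi> \<and> sat scale V \<theta> e \<psi>"
| "sat scale V \<theta> e (Exi i \<phi>) \<longleftrightarrow> (\<exists>a\<in>V. sat scale V \<theta> (e(i := a)) \<phi>)"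

primrec quantifier_free :: "'k fm \<Rightarrow> bool" where
  "quantifier_free (Equal s t) \<longleftrightarrow> True"
| "quantifier_free (Neg \<phi>) \<longleftrightarrow> quantifier_free \<phi>"
| "quantifier_free (Conj \<phi> \<psi>) \<longleftrightarrow> quantifier_free \<phi> \<and> quantifier_free \<psi>"
| "quantifier_free (Exi i \<phi>) \<longleftrightarrow> False"

inductive existential :: "'k fm \<Rightarrow> bool" where
  "quantifier_free \<phi> \<Longrightarrow> existential \<phi>"
| "existential \<phi> \<Longrightarrow> existential (Exi i \<phi>)"

definition embedding ::
    "('k::field \<Rightarrow> 'v::ab_group_add \<Rightarrow> 'v) \<Rightarrow> 'v set \<Rightarrow> ('v \<Rightarrow> 'v) \<Rightarrow>
     ('k \<Rightarrow> 'w::ab_group_add \<Rightarrow> 'w) \<Rightarrow> 'w set \<Rightarrow> ('w \<Rightarrow> 'w) \<Rightarrow> ('v \<Rightarrow> 'w) \<Rightarrow> bool" where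
  "embedding scale V \<theta> scale' N \<eta> h \<longleftrightarrow>
     inj_on h V \<and> h ` V \<subseteq> N \<and>
     h 0 = 0 \<and>
     (\<forall>x\<in>V. \<forall>y\<in>V. h (x + y) = h x + h y) \<and>
     (\<forall>a. \<forall>x\<in>V. h (scale a x) = scale' a (h x)) \<and>
     (\<forall>x\<in>V. h (\<theta> x) = \<eta> (h x))"

text \<open>Existential closedness in the class of models of the theory, where extensions are taken up
  to isomorphism and range over all models \<open>(N, \<eta>)\<close> whose vector space \<open>N\<close> is a linear subspace
  of the space with scalar multiplication \<open>scaleW\<close>; \<open>\<eta>\<close> is arbitrary.
  HOL cannot quantify over types within a formula, so this ambient space is a parameter. It
  imposes no restriction when it is large, in the sense of \<open>large_for\<close> below: if an existential
  formula with parameters in \<open>V\<close> holds in some model extending \<open>V\<close>, it already holds in the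
  \<open>\<theta>\<close>-invariant subspace generated by \<open>V\<close> and finitely many witnesses; this is again a model, as
  being a \<open>C\<close>-endomorphism passes to invariant subspaces, and its dimension is at most
  \<open>dim V + \<aleph>\<^sub>0 \<le> |V|\<close>.\<close>

definition existentially_closed ::
    "('k \<Rightarrow> 'w::ab_group_add \<Rightarrow> 'w) \<Rightarrow> 'k::field kconf \<Rightarrow>
     ('k \<Rightarrow> 'v::ab_group_add \<Rightarrow> 'v) \<Rightarrow> 'v set \<Rightarrow> ('v \<Rightarrow> 'v) \<Rightarrow> bool" where
  "existentially_closed scaleW C scale V \<theta> \<longleftrightarrow>
     (\<forall>N \<eta> h. models_T C scaleW N \<eta> \<and> embedding scale V \<theta> scaleW N \<eta> h \<longrightarrow>
        (\<forall>\<phi> e. existential \<phi> \<and> range e \<subseteq> V \<and> sat scaleW N \<eta> (h \<circ> e) \<phi> \<longrightarrow>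
           sat scale V \<theta> e \<phi>))"

definition large_for ::
    "('k::field \<Rightarrow> 'w::ab_group_add \<Rightarrow> 'w) \<Rightarrow> 'v set \<Rightarrow> bool" where
  "large_for scaleW V \<longleftrightarrow>
     (\<exists>B. \<not> module.dependent scaleW B \<and> V \<lesssim> B)"

end

theory Submission
  imports Defs "HOL-Library.Product_Plus"
begin

text \<open>
  A vector space with an endomorphism \<open>\<theta>\<close> is a \<open>K[X]\<close>-module in which \<open>\<rho>\<close> acts as \<open>\<rho>[\<theta>]\<close>, and an
  extension of models is an inclusion of modules, so both directions are statements about the
  principal ideal domain \<open>K[X]\<close>.

  Suppose that \<open>V\<close> is \<open>C\<close>-complete and that an existential formula with parameters in \<open>V\<close> holds in a
  model \<open>N \<supseteq> V\<close>. The formula speaks about finitely many witnesses \<open>b\<^sub>1, \<dots>, b\<^sub>n\<close> and about the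
  vanishing or not of finitely many terms in them. It therefore suffices to find a submodule \<open>S\<close>
  with \<open>V \<union> {b\<^sub>1, \<dots>, b\<^sub>n} \<subseteq> S \<subseteq> N\<close> such that, for every finite \<open>F \<subseteq> S - {0}\<close>, some module
  homomorphism \<open>S \<rightarrow> V\<close> fixes \<open>V\<close> and vanishes nowhere on \<open>F\<close>; it carries the witnesses into \<open>V\<close>.
  Such an \<open>S\<close> is built from \<open>V\<close> by adjoining one element \<open>t\<close> at a time, and only two kinds of
  steps are needed. If \<open>t\<close> is torsion over \<open>V\<close>, it may be assumed that \<open>f t\<close> already lies in the
  submodule for some monic irreducible \<open>f\<close>. The image of \<open>t\<close> must then be chosen in the fibre of
  \<open>f\<close> over the image of \<open>f t\<close>, outside a finite set, and the completeness conditions on images and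
  fibres say that this fibre is infinite (lemma \<open>infinite_fibre_retraction\<close>). If \<open>t\<close> is free over
  the submodule, its image is arbitrary up to finitely many conditions \<open>\<rho> x \<noteq> u\<close> with
  \<open>\<rho> \<noteq> 0\<close>, which can be met by the genericity condition. The order matters, because
  mapping a free element carelessly could destroy divisibility needed later: all torsion has to come
  first. The Euclidean algorithm makes this possible (lemma \<open>relation_reduction\<close>): whenever the
  \<open>b\<^sub>i\<close> satisfy a nontrivial relation modulo the torsion elements, they can be replaced by \<open>n\<close> other
  generators, one of which is torsion.

  Conversely, suppose that \<open>V\<close> is existentially closed. Each completeness condition asks for a
  solution in \<open>V\<close> of an equation \<open>\<rho> x = u\<close> and finitely many inequations \<open>\<sigma> x \<noteq> w\<close>.
  The module \<open>(V \<times> K[X]) / K[X](u, -\<rho>)\<close> contains \<open>V\<close> and a generic solution, namely the class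
  of \<open>(0, 1)\<close>. If it is a model, the solution can be pulled back to \<open>V\<close>
  (lemma \<open>root_realized\<close>). This is applied with \<open>\<rho> = f\<close> for the fibre conditions, with
  \<open>\<rho> = f ^ (C(f) + 1)\<close> for the condition on images and with \<open>\<rho> = 0\<close> for the genericity
  condition; in each case divisibility in \<open>K[X]\<close> shows that the extension is a model.
\<close>

section \<open>Polynomials over a field\<close>

text \<open>The nonzero element of least degree in the ideal generated by \<open>f\<close> and \<open>g\<close> divides both, and an
  irreducible \<open>f\<close> that does not divide \<open>g\<close> leaves only units.\<close>

lemma irreducible_bezout:
  fixes f g :: "'k::field poly"
  assumes "irreducible f" and "\<not> f dvd g"
  obtains a b where "a * f + b * g = 1"
proof -
  let ?I = "{a * f + b * g |a b. True}"
  have closed: "x - q * y \<in> ?I" if "x \<in> ?I" "y \<in> ?I" for x y q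
  proof -
    from that obtain a b a' b' where "x = a * f + b * g" "y = a' * f + b' * g" by auto
    then have "x - q * y = (a - q * a') * f + (b - q * b') * g" by (simp add: algebra_simps)
    then show ?thesis by blast
  qed
  have fI: "f \<in> ?I" and gI: "g \<in> ?I"
    by (intro CollectI exI[of _ 1] exI[of _ 0], simp)
       (intro CollectI exI[of _ 0] exI[of _ 1], simp)
  have "f \<noteq> 0" using assms(1) by auto
  then obtain d where d: "d \<in> ?I" "d \<noteq> 0"
    and least: "\<And>y. y \<in> ?I \<and> y \<noteq> 0 \<Longrightarrow> degree d \<le> degree y"
    using ex_has_least_nat[of "\<lambda>d. d \<in> ?I \<and> d \<noteq> 0", OF conjI[OF fI], of degree] by blast
  have dvd: "d dvd y" if "y \<in> ?I" for y
  proof -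
    have "y mod d \<in> ?I" using closed[OF that d(1), of "y div d"] by (simp add: minus_div_mult_eq_mod)
    then have "y mod d = 0" using least[of "y mod d"] degree_mod_less'[of d y] d(2) by fastforce
    then show ?thesis by (simp add: mod_eq_0_iff_dvd)
  qed
  from dvd[OF fI] obtain m where m: "f = d * m" by blast
  have "\<not> m dvd 1"
  proof
    assume "m dvd 1"
    then have "f dvd d" by (metis dvd_mult_unit_iff dvd_refl m)
    with dvd[OF gI] assms(2) show False using dvd_trans by blast
  qed
  then have "d dvd 1" using irreducibleD[OF assms(1) m] by blast
  then obtain e where e: "1 = d * e" by blast
  from d(1) obtain a b where "d = a * f + b * g" by blast
  with e have "(e * a) * f + (e * b) * g = 1" by (simp add: algebra_simps)
  then show thesis by (rule that)
qed

lemma irreducible_imp_prime_elem: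
  fixes f :: "'k::field poly"
  assumes "irreducible f"
  shows "prime_elem f"
proof (rule prime_elemI)
  show "f \<noteq> 0" "\<not> f dvd 1" using assms by (auto simp: irreducible_def)
  fix g p assume gp: "f dvd g * p"
  show "f dvd g \<or> f dvd p"
  proof (rule disjCI)
    assume "\<not> f dvd p"
    then obtain a b where "a * f + b * p = 1" using irreducible_bezout[OF assms] by blast
    then have "g = g * (a * f + b * p)" by simp
    also have "\<dots> = f * (a * g) + b * (g * p)" by (simp add: algebra_simps)
    finally show "f dvd g" by (metis gp dvd_add dvd_mult dvd_triv_left)
  qed
qed

text \<open>Each factor \<open>f\<close> on the left divides \<open>p\<close> by primality and can then be cancelled.\<close>

lemma irreducible_power_dvd_mult:
  fixes f g :: "'k::field poly"
  assumes f: "irreducible f" and "f ^ m dvd g * p" and "\<not> f dvd g"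
  shows "f ^ m dvd p"
  using assms(2)
proof (induction m arbitrary: p)
  case (Suc m)
  have "f dvd g * p" using Suc.prems unfolding power_Suc by (rule dvd_mult_left)
  then have "f dvd p"
    using prime_elem_dvd_multD[OF irreducible_imp_prime_elem[OF f]] assms(3) by blast
  then obtain p' where p': "p = f * p'" by blast
  have "f \<noteq> 0" using f by (auto simp: irreducible_def)
  moreover have "f * f ^ m dvd f * (g * p')" using Suc.prems p' by (simp add: mult.left_commute)
  ultimately have "f ^ m dvd g * p'" by auto
  then have "f ^ m dvd p'" by (rule Suc.IH)
  then show ?case unfolding p' power_Suc by (rule mult_dvd_mono[OF dvd_refl])
next
  case 0
  show ?case by simp
qed

lemma irreducible_dvd_prod:
  fixes f :: "'k::field poly"
  assumes "irreducible f" and "finite A" and "f dvd prod g A"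
  shows "\<exists>x\<in>A. f dvd g x"
  using assms(2,3)
proof (induction A)
  case empty
  then show ?case using assms(1) by (simp add: irreducible_def)
next
  case (insert x A)
  then have "f dvd g x * prod g A" by simp
  then show ?case
    using prime_elem_dvd_multD[OF irreducible_imp_prime_elem[OF assms(1)]] insert.IH by blast
qed

lemma monic_irreducible_dvd_imp_eq:
  assumes "f \<in> monic_irreducibles" "g \<in> monic_irreducibles" "f dvd g"
  shows "f = g"
proof -
  have f: "irreducible f" "lead_coeff f = 1" and g: "irreducible g" "lead_coeff g = 1"
    using assms(1,2) by (auto simp: monic_irreducibles_def)
  obtain m where m: "g = f * m" using assms(3) by blast
  have "m dvd 1" using irreducibleD[OF g(1) m] f(1) irreducible_def by blast
  then obtain c where c: "m = [:c:]" by (metis is_unit_polyE)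
  have "lead_coeff g = lead_coeff f * lead_coeff m" by (simp add: m lead_coeff_mult)
  then have "c = 1" using f(2) g(2) c by simp
  with c m show ?thesis by simp
qed

lemma ex_monic_irreducible_dvd:
  fixes \<rho> :: "'k::field poly"
  assumes "0 < degree \<rho>"
  obtains f where "f \<in> monic_irreducibles" "f dvd \<rho>"
proof -
  obtain g where g: "g dvd \<rho>" "0 < degree g"
    and least: "\<And>h. h dvd \<rho> \<and> 0 < degree h \<Longrightarrow> degree g \<le> degree h"
    using ex_has_least_nat[of "\<lambda>g. g dvd \<rho> \<and> 0 < degree g", OF conjI[OF dvd_refl assms], of degree]
    by blast
  have g0: "g \<noteq> 0" using g(2) by auto
  define f where "f = smult (inverse (lead_coeff g)) g"
  have "irreducible g"
  proof (rule irreducibleI)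
    show "g \<noteq> 0" by fact
    show "\<not> g dvd 1" using g(2) g0 is_unit_iff_degree by (metis less_irrefl)
    fix a b assume ab: "g = a * b"
    with g0 have ab0: "a \<noteq> 0" "b \<noteq> 0" by auto
    have deg: "degree g = degree a + degree b" unfolding ab using ab0 by (rule degree_mult_eq)
    have "a dvd \<rho>" using ab g(1) by (meson dvd_mult_left)
    then have "degree a = 0 \<or> degree b = 0" using least[of a] deg by (cases "degree a = 0") auto
    then show "a dvd 1 \<or> b dvd 1" using ab0 by (simp add: is_unit_iff_degree)
  qed
  moreover have unit: "[:inverse (lead_coeff g):] dvd 1"
    using g0 by (simp add: is_unit_const_poly_iff dvd_field_iff)
  moreover have f: "f = [:inverse (lead_coeff g):] * g" by (simp add: f_def)
  ultimately have "irreducible f" by (metis irreducible_mult_unit_left)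
  moreover have "lead_coeff f = 1" using g0 by (simp add: f_def)
  moreover have "f dvd \<rho>" using g(1) unit f by (metis mult_unit_dvd_iff')
  ultimately show thesis using that by (auto simp: monic_irreducibles_def)
qed

lemma monic_irreducibleD:
  assumes "f \<in> monic_irreducibles"
  shows "irreducible f" "f \<noteq> 0" "0 < degree f" "\<not> f dvd 1"
proof -
  show f: "irreducible f" using assms by (simp add: monic_irreducibles_def)
  then show "f \<noteq> 0" "\<not> f dvd 1" by (auto simp: irreducible_def)
  then show "0 < degree f" by (simp add: is_unit_iff_degree)
qed

text \<open>Coprimality to \<open>f\<close> passes to the powers of \<open>f\<close>: multiply the relations for \<open>f ^ n\<close> and for \<open>f\<close>.\<close>

lemma irreducible_power_bezout:
  fixes f g :: "'k::field poly"
  assumes "irreducible f" and "\<not> f dvd g"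
  shows "\<exists>a b. a * f ^ n + b * g = 1"
proof (induction n)
  case 0
  show ?case by (intro exI[of _ 1] exI[of _ 0]) simp
next
  case (Suc n)
  then obtain a b where ab: "a * f ^ n + b * g = 1" by blast
  obtain a' b' where ab': "a' * f + b' * g = 1" using irreducible_bezout[OF assms] .
  have "1 = (a * f ^ n + b * g) * (a' * f + b' * g)" by (simp add: ab ab')
  also have "\<dots> = (a * a') * f ^ Suc n + (a * f ^ n * b' + b * (a' * f + b' * g)) * g"
    by (simp add: algebra_simps)
  finally show ?case by metis
qed

lemma irreducible_factor_out:
  fixes f \<rho> :: "'k::field poly"
  assumes "irreducible f" and "\<rho> \<noteq> 0"
  shows "\<exists>l \<sigma>. \<rho> = f ^ l * \<sigma> \<and> \<not> f dvd \<sigma>"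
  using assms(2)
proof (induction "degree \<rho>" arbitrary: \<rho> rule: less_induct)
  case less
  show ?case
  proof (cases "f dvd \<rho>")
    case False
    then show ?thesis by (intro exI[of _ 0] exI[of _ \<rho>]) simp
  next
    case True
    then obtain \<rho>' where \<rho>': "\<rho> = f * \<rho>'" by blast
    with less.prems have nz: "f \<noteq> 0" "\<rho>' \<noteq> 0" by auto
    have "degree f \<noteq> 0" using assms(1) nz by (auto simp: irreducible_def is_unit_iff_degree)
    then have "degree \<rho>' < degree \<rho>" using nz by (simp add: \<rho>' degree_mult_eq)
    then obtain l \<sigma> where "\<rho>' = f ^ l * \<sigma>" "\<not> f dvd \<sigma>" using less.hyps nz by blast
    then show ?thesis by (intro exI[of _ "Suc l"] exI[of _ \<sigma>]) (simp add: \<rho>')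
  qed
qed

section \<open>The minimal polynomial of a kernel configuration\<close>

lemma MiPo_nonzero: "MiPo C \<noteq> 0"
proof -
  have "f ^ the_enat (fst C f) \<noteq> 0" if "f \<in> kconf_support C" for f
    using that monic_irreducibleD(2)[of f] by (simp add: kconf_support_def)
  then show ?thesis
    unfolding MiPo_def by (metis (mono_tags) prod.infinite prod_zero_iff zero_neq_one)
qed

text \<open>A finite degree bounds every summand \<open>deg(f) C(f)\<close>, and \<open>deg(f) > 0\<close>.\<close>

lemma algebraic_imp_finite:
  assumes "kernel_configuration C" "algebraic C"
  shows "finite (kconf_support C)" and "f \<in> monic_irreducibles \<Longrightarrow> fst C f < \<infinity>"
proof -
  show fin: "finite (kconf_support C)"
    using assms by (auto simp: kernel_configuration_def algebraic_def)
  assume f: "f \<in> monic_irreducibles"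
  show "fst C f < \<infinity>"
  proof (rule ccontr)
    assume "\<not> fst C f < \<infinity>"
    then have inf: "fst C f = \<infinity>" by simp
    then have "f \<in> kconf_support C" using f by (simp add: kconf_support_def)
    then have "enat (degree f) * fst C f \<le> (\<Sum>f\<in>kconf_support C. enat (degree f) * fst C f)"
      using fin by (simp add: sum.remove)
    then have "enat (degree f) * fst C f \<le> snd C"
      using assms by (auto simp: kernel_configuration_def algebraic_def)
    then show False using inf monic_irreducibleD(3)[OF f] assms(2)
      by (auto simp: algebraic_def imult_is_infinity zero_enat_def)
  qed
qed

text \<open>The \<open>f\<close>-primary part of the minimal polynomial is exactly \<open>f ^ C(f)\<close>, since distinct monic
  irreducibles do not divide each other. It also holds outside the support, where
  \<open>C(f) = 0\<close>.\<close>

lemma MiPo_split: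
  assumes "kernel_configuration C" "algebraic C" and f: "f \<in> monic_irreducibles"
  obtains m where "MiPo C = f ^ the_enat (fst C f) * m" and "\<not> f dvd m"
proof
  let ?p = "\<lambda>g. g ^ the_enat (fst C g)"
  let ?m = "\<Prod>g\<in>kconf_support C - {f}. ?p g"
  have fin: "finite (kconf_support C)" using algebraic_imp_finite assms by blast
  show "MiPo C = ?p f * ?m"
  proof (cases "f \<in> kconf_support C")
    case True
    then show ?thesis unfolding MiPo_def by (simp add: prod.remove[OF fin])
  next
    case False
    then have "fst C f = 0" using f by (simp add: kconf_support_def)
    then show ?thesis using False by (simp add: MiPo_def zero_enat_def)
  qed
  show "\<not> f dvd ?m"
  proof
    assume "f dvd ?m"
    then obtain g where g: "g \<in> kconf_support C - {f}" "f dvd ?p g"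
      using irreducible_dvd_prod[OF monic_irreducibleD(1)[OF f], of "kconf_support C - {f}" ?p] fin
      by blast
    then have "f = g"
      using prime_elem_dvd_power[OF irreducible_imp_prime_elem[OF monic_irreducibleD(1)[OF f]]] monic_irreducible_dvd_imp_eq[OF f]
      by (auto simp: kconf_support_def)
    with g show False by blast
  qed
qed

section \<open>The polynomial action of an endomorphism\<close>

lemma poly_endo_eq_sum:
  assumes "vector_space scale" "degree \<rho> \<le> n"
  shows "poly_endo scale \<rho> \<theta> x = (\<Sum>i\<le>n. scale (coeff \<rho> i) ((\<theta> ^^ i) x))"
proof -
  interpret vector_space scale by fact
  show ?thesis unfolding poly_endo_def
    by (rule sum.mono_neutral_left) (use assms(2) in \<open>auto simp: coeff_eq_0\<close>)
qed

text \<open>This Horner rule is the form of the action used in inductions over polynomials.\<close>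

lemma poly_endo_pCons:
  assumes "vector_space scale" "endomorphism_on scale UNIV \<theta>"
  shows "poly_endo scale (pCons a p) \<theta> x = scale a x + \<theta> (poly_endo scale p \<theta> x)"
proof -
  interpret vector_space scale by fact
  interpret \<theta>: additive \<theta> using assms(2) by (simp add: additive_def endomorphism_on_def)
  have \<theta>: "\<theta> (scale c y) = scale c (\<theta> y)" for c y using assms(2) by (simp add: endomorphism_on_def)
  have "poly_endo scale (pCons a p) \<theta> x
      = (\<Sum>i\<le>Suc (degree p). scale (coeff (pCons a p) i) ((\<theta> ^^ i) x))"
    by (rule poly_endo_eq_sum) (use assms(1) in \<open>auto simp: degree_pCons_le\<close>)
  also have "\<dots> = scale a x + (\<Sum>i\<le>degree p. scale (coeff p i) (\<theta> ((\<theta> ^^ i) x)))"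
    by (simp add: sum.atMost_Suc_shift del: sum.atMost_Suc)
  also have "\<dots> = scale a x + \<theta> (poly_endo scale p \<theta> x)"
    by (simp add: poly_endo_def \<theta>.sum \<theta>)
  finally show ?thesis .
qed

lemma poly_endo_0: "vector_space scale \<Longrightarrow> poly_endo scale 0 \<theta> x = 0"
  by (simp add: poly_endo_def module.scale_zero_left module_iff_vector_space)

lemma module_poly_endo:
  assumes vs: "vector_space scale" and endo: "endomorphism_on scale UNIV \<theta>"
  shows "module (\<lambda>\<rho>. poly_endo scale \<rho> \<theta>)"
proof -
  interpret vector_space scale by fact
  interpret \<theta>: additive \<theta> using endo by (simp add: additive_def endomorphism_on_def)
  have \<theta>: "\<theta> (scale c y) = scale c (\<theta> y)" for c y using endo by (simp add: endomorphism_on_def)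
  note pCons = poly_endo_pCons[OF vs endo]
  note zero [simp] = poly_endo_0[OF vs]
  have add_right: "poly_endo scale p \<theta> (x + y) = poly_endo scale p \<theta> x + poly_endo scale p \<theta> y"
    for p x y
    by (induction p) (simp_all add: pCons \<theta>.add algebra_simps)
  have add_left: "poly_endo scale (p + q) \<theta> x = poly_endo scale p \<theta> x + poly_endo scale q \<theta> x"
    for p q x
    by (induction p q rule: poly_induct2) (simp_all add: pCons \<theta>.add algebra_simps)
  have smult: "poly_endo scale (smult a p) \<theta> x = scale a (poly_endo scale p \<theta> x)" for a p x
    by (induction p) (simp_all add: pCons \<theta> scale_right_distrib)
  have mult: "poly_endo scale (p * q) \<theta> x = poly_endo scale p \<theta> (poly_endo scale q \<theta> x)" for p q x
    by (induction p) (simp_all add: pCons add_left smult)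
  show ?thesis
  proof
    show "poly_endo scale 1 \<theta> x = x" for x
      by (simp add: one_pCons pCons \<theta>.zero)
  qed (simp_all add: add_right add_left mult)
qed

lemma poly_endo_hom:
  assumes "\<And>x y. h (x + y) = h x + h y" "\<And>a x. h (scale a x) = scale' a (h x)"
    and "\<And>x. h (\<theta> x) = \<eta> (h x)"
  shows "poly_endo scale' \<rho> \<eta> (h x) = h (poly_endo scale \<rho> \<theta> x)"
proof -
  interpret h: additive h using assms(1) by (simp add: additive_def)
  have "(\<eta> ^^ i) (h x) = h ((\<theta> ^^ i) x)" for i
    by (induction i) (simp_all add: assms(3))
  then show ?thesis by (simp add: poly_endo_def h.sum assms(2))
qed

text \<open>Precompose with a linear projection onto \<open>N\<close>. A total endomorphism makes the whole ambient space a
  \<open>K[X]\<close>-module, of which \<open>N\<close> is then a submodule.\<close>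

lemma extend_endomorphism:
  assumes vs: "vector_space scale" and N: "module.subspace scale N"
    and \<eta>: "endomorphism_on scale N \<eta>"
  obtains \<eta>' where "endomorphism_on scale UNIV \<eta>'" "\<And>x. x \<in> N \<Longrightarrow> \<eta>' x = \<eta> x"
proof -
  interpret vector_space scale by fact
  interpret vector_space_pair scale scale ..
  obtain \<pi> where \<pi>: "range \<pi> \<subseteq> N" "Vector_Spaces.linear scale scale \<pi>" "\<And>x. x \<in> N \<Longrightarrow> \<pi> x = x"
    using linear_exists_left_inverse_on[OF linear_id N] by auto
  interpret \<pi>: Vector_Spaces.linear scale scale \<pi> by fact
  show thesis
  proof (rule that[of "\<eta> \<circ> \<pi>"])
    have "\<pi> x \<in> N" for x using \<pi>(1) by auto
    then show "endomorphism_on scale UNIV (\<eta> \<circ> \<pi>)"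
      using \<eta> by (simp add: endomorphism_on_def \<pi>.add \<pi>.scale)
  qed (simp add: \<pi>)
qed

lemma poly_endo_cong:
  assumes "\<And>x. x \<in> N \<Longrightarrow> \<eta>' x = \<eta> x" "\<And>x. x \<in> N \<Longrightarrow> \<eta> x \<in> N" and "x \<in> N"
  shows "poly_endo scale \<rho> \<eta>' x = poly_endo scale \<rho> \<eta> x"
proof -
  have "(\<eta>' ^^ i) x = (\<eta> ^^ i) x \<and> (\<eta> ^^ i) x \<in> N" for i
    by (induction i) (simp_all add: assms)
  then show ?thesis by (simp add: poly_endo_def)
qed

lemma poly_endo_const: "poly_endo scale [:a:] \<theta> x = scale a x"
  by (simp add: poly_endo_def)

lemma poly_endo_X:
  assumes "vector_space scale"
  shows "poly_endo scale [:0, 1:] \<theta> x = \<theta> x"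
proof -
  interpret vector_space scale by fact
  show ?thesis by (simp add: poly_endo_def)
qed

lemma subspace_poly_endo_iff:
  assumes vs: "vector_space scale" and endo: "endomorphism_on scale UNIV \<theta>"
  shows "module.subspace (\<lambda>\<rho>. poly_endo scale \<rho> \<theta>) S \<longleftrightarrow>
    module.subspace scale S \<and> (\<forall>x\<in>S. \<theta> x \<in> S)"
proof -
  interpret vector_space scale by fact
  interpret X: module "\<lambda>\<rho>. poly_endo scale \<rho> \<theta>" by (rule module_poly_endo[OF vs endo])
  show ?thesis
  proof (intro iffI conjI ballI)
    assume S: "X.subspace S"
    show "subspace S"
      using X.subspace_0[OF S] X.subspace_add[OF S] X.subspace_scale[OF S, of _ "[:_:]"]
      by (intro subspaceI) (simp_all add: poly_endo_const)
    show "\<theta> x \<in> S" if "x \<in> S" for x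
      using X.subspace_scale[OF S that, of "[:0, 1:]"] by (simp add: poly_endo_X[OF vs])
  next
    assume S: "subspace S \<and> (\<forall>x\<in>S. \<theta> x \<in> S)"
    show "X.subspace S"
    proof (rule X.subspaceI)
      show "poly_endo scale \<rho> \<theta> x \<in> S" if x: "x \<in> S" for \<rho> x
        by (induction \<rho>)
          (use S x in \<open>simp_all add: subspace_0 poly_endo_pCons[OF vs endo] subspace_add subspace_scale\<close>)
    qed (use S in \<open>simp_all add: subspace_0 subspace_add\<close>)
  qed
qed

text \<open>In the algebraic case kernels stabilize automatically: \<open>f ^ C(f)\<close> is the greatest common divisor of
  \<open>f ^ (C(f) + 1)\<close> and the minimal polynomial.\<close>

lemma monic_irreducible_kernel_stable:
  assumes "kernel_configuration C" "algebraic C" and f: "f \<in> monic_irreducibles"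
    and "module s" and "s (MiPo C) x = 0" and "s (f ^ (the_enat (fst C f) + 1)) x = 0"
  shows "s (f ^ the_enat (fst C f)) x = 0"
proof -
  interpret module s by fact
  let ?n = "the_enat (fst C f)"
  obtain m where m: "MiPo C = f ^ ?n * m" "\<not> f dvd m" using MiPo_split[OF assms(1-3)] .
  obtain a b where "a * f + b * m = 1"
    using irreducible_bezout[OF monic_irreducibleD(1)[OF f] m(2)] .
  then have "f ^ ?n = (a * f + b * m) * f ^ ?n" by simp
  also have "\<dots> = a * f ^ (?n + 1) + b * MiPo C" by (simp add: m(1) algebra_simps)
  finally have "s (f ^ ?n) x = s a (s (f ^ (?n + 1)) x) + s b (s (MiPo C) x)"
    by (simp add: scale_left_distrib del: power_Suc)
  with assms(5,6) show ?thesis by simp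
qed

lemma sum_remove_two:
  assumes "finite I" "i \<in> I" "j \<in> I" "i \<noteq> j"
  shows "sum u I = u i + u j + sum u (I - {i, j})"
proof -
  have "sum u I = u i + sum u (I - {i})" using assms(1,2) by (rule sum.remove)
  moreover have "sum u (I - {i}) = u j + sum u (I - {i} - {j})" by (rule sum.remove) (use assms in auto)
  moreover have "I - {i} - {j} = I - {i, j}" by blast
  ultimately show ?thesis by (simp add: add.assoc)
qed

section \<open>Retractions onto a complete module\<close>

text \<open>The conditions on \<open>c\<close> are those satisfied by a \<open>C\<close>-complete \<open>V\<close> inside a model \<open>N\<close>, with the
  algebraic and the transcendental case treated alike: kernels of \<open>f ^ c(f)\<close> stabilize in \<open>N\<close> in
  both, and in the algebraic case the genericity condition is replaced by a common annihilator of \<open>N\<close>,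
  which excludes free elements.\<close>

locale complete_module_extension =
  V: module sv + W: module sw
  for sv :: "'k::field poly \<Rightarrow> 'v::ab_group_add \<Rightarrow> 'v" (infixr \<open>*V\<close> 75)
    and sw :: "'k poly \<Rightarrow> 'w::ab_group_add \<Rightarrow> 'w" (infixr \<open>*W\<close> 75) +
  fixes h :: "'v \<Rightarrow> 'w" and N :: "'w set" and c :: "'k poly \<Rightarrow> enat"
  assumes h_add: "h (x + y) = h x + h y"
    and h_scale: "h (\<rho> *V x) = \<rho> *W h x"
    and inj_h: "inj h"
    and range_h: "range h \<subseteq> N"
    and subspace_N: "W.subspace N"
    and Ker_stable: "\<lbrakk>f \<in> monic_irreducibles; c f < \<infinity>; w \<in> N; f ^ (the_enat (c f) + 1) *W w = 0\<rbrakk>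
      \<Longrightarrow> f ^ the_enat (c f) *W w = 0"
    and Im_stable: "\<lbrakk>f \<in> monic_irreducibles; c f < \<infinity>\<rbrakk>
      \<Longrightarrow> \<exists>z. f ^ the_enat (c f) *V x = f ^ (the_enat (c f) + 1) *V z"
    and infinite_fibre_finite: "\<lbrakk>f \<in> monic_irreducibles; 0 < c f; c f < \<infinity>;
      f ^ (the_enat (c f) - 1) *V u = 0\<rbrakk> \<Longrightarrow> infinite {x. f *V x = u}"
    and infinite_fibre_infinite: "\<lbrakk>f \<in> monic_irreducibles; c f = \<infinity>\<rbrakk> \<Longrightarrow> infinite {x. f *V x = u}"
    and bounded_or_generic: "(\<exists>\<mu>. \<mu> \<noteq> 0 \<and> (\<forall>y\<in>N. \<mu> *W y = 0)) \<or>
      (\<forall>F. finite F \<and> (\<forall>(\<rho>, u)\<in>F. \<rho> \<noteq> 0) \<longrightarrow> (\<exists>x. \<forall>(\<rho>, u)\<in>F. \<rho> *V x \<noteq> u))"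
begin

lemma h_zero [simp]: "h 0 = 0"
  using h_scale[of 0] by simp

lemma h_diff: "h (x - y) = h x - h y"
  by (metis add_diff_cancel h_add diff_add_cancel)

lemma Ker_stable_add:
  assumes f: "f \<in> monic_irreducibles" "c f < \<infinity>" and "y \<in> N"
    and "f ^ (the_enat (c f) + k) *W y = 0"
  shows "f ^ the_enat (c f) *W y = 0"
  using assms(4)
proof (induction k)
  case (Suc k)
  have "f ^ k *W y \<in> N" using subspace_N assms(3) by (simp add: W.subspace_scale)
  moreover have "f ^ (the_enat (c f) + 1) *W f ^ k *W y = 0"
    using Suc.prems by (simp add: power_add mult_ac)
  ultimately have "f ^ the_enat (c f) *W f ^ k *W y = 0" by (rule Ker_stable[OF f])
  then show ?case using Suc.IH by (simp add: power_add)
qed simp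

lemma Im_stable_add:
  assumes f: "f \<in> monic_irreducibles" "c f < \<infinity>"
  shows "\<exists>z. f ^ the_enat (c f) *V x = f ^ (the_enat (c f) + k) *V z"
proof (induction k)
  case 0
  show ?case by auto
next
  case (Suc k)
  then obtain z where z: "f ^ the_enat (c f) *V x = f ^ (the_enat (c f) + k) *V z" by blast
  obtain z' where z': "f ^ the_enat (c f) *V z = f ^ (the_enat (c f) + 1) *V z'"
    using Im_stable[OF f] by blast
  have "f ^ (the_enat (c f) + k) *V z = f ^ k *V f ^ the_enat (c f) *V z"
    by (simp add: power_add mult_ac)
  also have "\<dots> = f ^ (the_enat (c f) + Suc k) *V z'"
    by (simp add: z' power_add mult_ac)
  finally show ?case using z by auto
qed

text \<open>These are the elements of \<open>N\<close> that are torsion modulo the copy of \<open>V\<close>, not the torsion elements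
  of \<open>N\<close>.\<close>

definition torsion :: "'w set" where
  "torsion = {y \<in> N. \<exists>\<rho>. \<rho> \<noteq> 0 \<and> \<rho> *W y \<in> range h}"

lemma subspace_range_h: "W.subspace (range h)"
  by (rule W.subspaceI) (auto simp flip: h_add h_scale h_zero)

lemma range_h_torsion: "range h \<subseteq> torsion"
proof
  fix y assume "y \<in> range h"
  then show "y \<in> torsion" using range_h by (auto simp: torsion_def intro!: exI[of _ 1])
qed

lemma subspace_torsion: "W.subspace torsion"
proof (rule W.subspaceI)
  show "0 \<in> torsion" using range_h_torsion h_zero by (metis rangeI subsetD)
next
  fix x y assume "x \<in> torsion" "y \<in> torsion"
  then obtain \<rho> \<sigma> where x: "x \<in> N" "\<rho> \<noteq> 0" "\<rho> *W x \<in> range h"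
    and y: "y \<in> N" "\<sigma> \<noteq> 0" "\<sigma> *W y \<in> range h"
    by (auto simp only: torsion_def mem_Collect_eq)
  have "(\<rho> * \<sigma>) *W (x + y) = \<sigma> *W \<rho> *W x + \<rho> *W \<sigma> *W y"
    by (simp add: W.scale_right_distrib mult.commute)
  also have "\<dots> \<in> range h"
    using x(3) y(3) subspace_range_h by (meson W.subspace_add W.subspace_scale)
  finally show "x + y \<in> torsion"
    using W.subspace_add[OF subspace_N x(1) y(1)] no_zero_divisors[OF x(2) y(2)]
    unfolding torsion_def by blast
next
  fix \<tau> x assume "x \<in> torsion"
  then obtain \<rho> where x: "x \<in> N" "\<rho> \<noteq> 0" "\<rho> *W x \<in> range h"
    by (auto simp only: torsion_def mem_Collect_eq)
  have "\<rho> *W \<tau> *W x = \<tau> *W \<rho> *W x" by (rule W.scale_left_commute)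
  also have "\<dots> \<in> range h" by (rule W.subspace_scale[OF subspace_range_h x(3)])
  finally show "\<tau> *W x \<in> torsion"
    using x W.subspace_scale[OF subspace_N] unfolding torsion_def by blast
qed

lemma torsion_saturated:
  assumes "y \<in> N" "\<rho> \<noteq> 0" "\<rho> *W y \<in> torsion"
  shows "y \<in> torsion"
proof -
  obtain \<sigma> where "\<sigma> \<noteq> 0" "\<sigma> *W \<rho> *W y \<in> range h"
    using assms(3) by (auto simp only: torsion_def mem_Collect_eq)
  then show ?thesis using assms(1,2) by (auto simp: torsion_def intro!: exI[of _ "\<sigma> * \<rho>"])
qed

text \<open>Up to a factor prime to \<open>f\<close> and after applying \<open>f ^ c(f)\<close>, a torsion element looks like an element of
  \<open>V\<close>. Indeed \<open>f ^ l \<sigma> t\<close> lies in \<open>V\<close>, where \<open>f ^ c(f) V\<close> is divisible by all powers of \<open>f\<close>; dividing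
  by \<open>f ^ l\<close> in \<open>V\<close> gives an element that differs from \<open>\<sigma> t\<close> by something killed by a power of \<open>f\<close>,
  hence by \<open>f ^ c(f)\<close>.\<close>

lemma torsion_local:
  assumes f: "f \<in> monic_irreducibles" "c f < \<infinity>" and t: "t \<in> torsion"
  obtains \<sigma> v where "\<not> f dvd \<sigma>" "f ^ the_enat (c f) *W \<sigma> *W t = h (f ^ the_enat (c f) *V v)"
proof -
  let ?n = "the_enat (c f)"
  obtain \<rho> m where "t \<in> N" and \<rho>: "\<rho> \<noteq> 0" "\<rho> *W t = h m"
    using t by (auto simp only: torsion_def mem_Collect_eq)
  then obtain l \<sigma> where \<sigma>: "\<rho> = f ^ l * \<sigma>" "\<not> f dvd \<sigma>"
    using irreducible_factor_out[OF monic_irreducibleD(1)[OF f(1)]] by blast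
  obtain z where z: "f ^ ?n *V m = f ^ (?n + (l + ?n)) *V z" using Im_stable_add[OF f] by blast
  \<comment> \<open>The factor \<open>f ^ n\<close> is kept in \<open>v\<close> so that \<open>f ^ (n + l) v\<close> and \<open>f ^ n m\<close> agree exactly.\<close>
  define v where "v = f ^ ?n *V z"
  have "f ^ (?n + l) *W (\<sigma> *W t - h v) = f ^ ?n *W \<rho> *W t - h (f ^ (?n + l) *V v)"
    by (simp add: W.scale_right_diff_distrib \<sigma>(1) h_scale power_add mult_ac)
  also have "\<dots> = h (f ^ ?n *V m - f ^ (?n + l) *V v)"
    by (simp add: h_diff h_scale \<rho>(2))
  also have "\<dots> = 0" by (simp add: z v_def power_add mult_ac)
  finally have "f ^ ?n *W (\<sigma> *W t - h v) = 0"
    using \<open>t \<in> N\<close> range_h subspace_N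
    by (intro Ker_stable_add[OF f]) (auto intro!: W.subspace_diff W.subspace_scale)
  then show thesis using \<sigma>(2) that[of \<sigma> v] by (simp add: W.scale_right_diff_distrib h_scale)
qed

definition retraction :: "'w set \<Rightarrow> ('w \<Rightarrow> 'v) \<Rightarrow> bool" where
  "retraction S g \<longleftrightarrow>
     (\<forall>x\<in>S. \<forall>y\<in>S. g (x + y) = g x + g y) \<and> (\<forall>\<rho>. \<forall>x\<in>S. g (\<rho> *W x) = \<rho> *V g x) \<and> (\<forall>v. g (h v) = v)"

lemma retractionD:
  assumes "retraction S g"
  shows "x \<in> S \<Longrightarrow> y \<in> S \<Longrightarrow> g (x + y) = g x + g y"
    and "x \<in> S \<Longrightarrow> g (\<rho> *W x) = \<rho> *V g x"
    and "g (h v) = v" and "g 0 = 0"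
proof -
  show "g (h v) = v" for v using assms by (simp add: retraction_def)
  from this[of 0] show "g 0 = 0" by simp
qed (use assms in \<open>simp_all add: retraction_def\<close>)

definition adjoin :: "'w set \<Rightarrow> 'w \<Rightarrow> 'w set" where
  "adjoin S t = {s + \<rho> *W t |s \<rho>. s \<in> S}"

lemma adjoinI: "s \<in> S \<Longrightarrow> s + \<rho> *W t \<in> adjoin S t"
  by (auto simp: adjoin_def)

lemma adjoinE:
  assumes "y \<in> adjoin S t"
  obtains s \<rho> where "s \<in> S" "y = s + \<rho> *W t"
  using assms by (auto simp: adjoin_def)

lemma subset_adjoin: "S \<subseteq> adjoin S t"
proof
  fix s assume "s \<in> S"
  then show "s \<in> adjoin S t" using adjoinI[of s S 0 t] by simp
qed

lemma mem_adjoin: "W.subspace S \<Longrightarrow> t \<in> adjoin S t"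
  using adjoinI[of 0 S 1 t] W.subspace_0 by simp

lemma adjoin_subset: "W.subspace T \<Longrightarrow> S \<subseteq> T \<Longrightarrow> t \<in> T \<Longrightarrow> adjoin S t \<subseteq> T"
  by (auto simp: adjoin_def intro!: W.subspace_add W.subspace_scale)

lemma subspace_adjoin:
  assumes "W.subspace S"
  shows "W.subspace (adjoin S t)"
proof (rule W.subspaceI)
  show "0 \<in> adjoin S t" using subset_adjoin W.subspace_0[OF assms] by blast
next
  fix x y assume "x \<in> adjoin S t" "y \<in> adjoin S t"
  then obtain s \<rho> s' \<rho>' where "s \<in> S" "x = s + \<rho> *W t" "s' \<in> S" "y = s' + \<rho>' *W t"
    by (elim adjoinE)
  then show "x + y \<in> adjoin S t"
    using adjoinI[OF W.subspace_add[OF assms], of s s' "\<rho> + \<rho>'" t] by (simp add: algebra_simps)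
next
  fix \<tau> x assume "x \<in> adjoin S t"
  then obtain s \<rho> where "s \<in> S" "x = s + \<rho> *W t" by (elim adjoinE)
  then show "\<tau> *W x \<in> adjoin S t"
    using adjoinI[OF W.subspace_scale[OF assms], of s \<tau> "\<tau> * \<rho>" t]
    by (simp add: W.scale_right_distrib)
qed

text \<open>A value \<open>x\<close> for \<open>t\<close> is admissible as soon as it respects the relations \<open>\<rho> t \<in> S\<close>.\<close>

lemma extend_retraction:
  assumes S: "W.subspace S" and range: "range h \<subseteq> S" and g: "retraction S g"
    and x: "\<And>\<rho>. \<rho> *W t \<in> S \<Longrightarrow> g (\<rho> *W t) = \<rho> *V x"
  obtains g' where "retraction (adjoin S t) g'"
    and "\<And>s \<rho>. s \<in> S \<Longrightarrow> g' (s + \<rho> *W t) = g s + \<rho> *V x"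
proof -
  define g' where "g' y = (SOME z. \<exists>s\<in>S. \<exists>\<rho>. y = s + \<rho> *W t \<and> z = g s + \<rho> *V x)" for y
  have well_defined: "g s + \<rho> *V x = g s' + \<rho>' *V x"
    if s: "s \<in> S" "s' \<in> S" and eq: "s + \<rho> *W t = s' + \<rho>' *W t" for s \<rho> s' \<rho>'
  proof -
    have diff: "(\<rho> - \<rho>') *W t = s' - s" using eq by (simp add: algebra_simps)
    then have "(\<rho> - \<rho>') *W t \<in> S" using W.subspace_diff[OF S] s by simp
    then have "g ((\<rho> - \<rho>') *W t) = (\<rho> - \<rho>') *V x" "g (s + (\<rho> - \<rho>') *W t) = g s + g ((\<rho> - \<rho>') *W t)"
      using x s(1) retractionD(1)[OF g] by auto
    then show ?thesis using diff by (simp add: algebra_simps)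
  qed
  have g': "g' (s + \<rho> *W t) = g s + \<rho> *V x" if s: "s \<in> S" for s \<rho>
    unfolding g'_def
  proof (rule some_equality)
    show "\<exists>s'\<in>S. \<exists>\<rho>'. s + \<rho> *W t = s' + \<rho>' *W t \<and> g s + \<rho> *V x = g s' + \<rho>' *V x"
      using s by blast
  next
    fix z assume "\<exists>s'\<in>S. \<exists>\<rho>'. s + \<rho> *W t = s' + \<rho>' *W t \<and> z = g s' + \<rho>' *V x"
    then show "z = g s + \<rho> *V x" using well_defined[OF s] by metis
  qed
  have "retraction (adjoin S t) g'"
    unfolding retraction_def
  proof (intro conjI ballI allI)
    fix y z assume "y \<in> adjoin S t" "z \<in> adjoin S t"
    then obtain s \<rho> s' \<rho>' where *: "s \<in> S" "y = s + \<rho> *W t" "s' \<in> S" "z = s' + \<rho>' *W t"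
      by (elim adjoinE)
    have "y + z = (s + s') + (\<rho> + \<rho>') *W t" by (simp add: * algebra_simps)
    then have "g' (y + z) = g (s + s') + (\<rho> + \<rho>') *V x" using g' W.subspace_add[OF S] * by metis
    then show "g' (y + z) = g' y + g' z"
      using * by (simp add: g' retractionD(1)[OF g] algebra_simps)
  next
    fix \<tau> y assume "y \<in> adjoin S t"
    then obtain s \<rho> where *: "s \<in> S" "y = s + \<rho> *W t" by (elim adjoinE)
    have "\<tau> *W y = \<tau> *W s + (\<tau> * \<rho>) *W t" by (simp add: * W.scale_right_distrib)
    then have "g' (\<tau> *W y) = g (\<tau> *W s) + (\<tau> * \<rho>) *V x"
      using g' W.subspace_scale[OF S] * by metis
    then show "g' (\<tau> *W y) = \<tau> *V g' y"
      using * by (simp add: g' retractionD(2)[OF g] V.scale_right_distrib)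
  next
    fix v
    have "h v \<in> S" using range by auto
    then show "g' (h v) = v" using g'[of "h v" 0] by (simp add: retractionD(3)[OF g])
  qed
  with g' show thesis by (rule that[rotated])
qed

text \<open>Quantifying over all finite sets \<open>F\<close>, rather than fixing one, is what lets the property pass from
  \<open>S\<close> to \<open>S + K[X] t\<close>: elements to be kept nonzero in the larger module impose new conditions on
  the smaller one.\<close>

definition separably_retractable :: "'w set \<Rightarrow> bool" where
  "separably_retractable S \<longleftrightarrow> W.subspace S \<and> range h \<subseteq> S \<and> S \<subseteq> N \<and>
     (\<forall>F. finite F \<and> F \<subseteq> S - {0} \<longrightarrow> (\<exists>g. retraction S g \<and> (\<forall>y\<in>F. g y \<noteq> 0)))"

lemma separably_retractableE:
  assumes "separably_retractable S" "finite F" "F \<subseteq> S - {0}"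
  obtains g where "retraction S g" "\<forall>y\<in>F. g y \<noteq> 0"
proof -
  have "\<exists>g. retraction S g \<and> (\<forall>y\<in>F. g y \<noteq> 0)"
    using assms by (simp add: separably_retractable_def)
  with that show thesis by blast
qed

lemma separably_retractable_range_h: "separably_retractable (range h)"
  unfolding separably_retractable_def
proof (intro conjI allI impI)
  fix F assume F: "finite F \<and> F \<subseteq> range h - {0}"
  have inv: "inv h (h v) = v" for v using inj_h by simp
  have "retraction (range h) (inv h)"
    by (auto simp: retraction_def inv simp flip: h_add h_scale)
  moreover have "\<forall>y\<in>F. inv h y \<noteq> 0" using F inv by auto
  ultimately show "\<exists>g. retraction (range h) g \<and> (\<forall>y\<in>F. g y \<noteq> 0)" by blast
qed (use subspace_range_h range_h in auto)

text \<open>Elements of \<open>F\<close> inside \<open>S\<close> are handled by the choice of \<open>g\<close> on \<open>S\<close>, the others by the choice of the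
  image \<open>x\<close> of \<open>t\<close>.\<close>

lemma separably_retractable_adjoin:
  assumes S: "separably_retractable S" and "t \<in> N"
    and witness: "\<And>g F. \<lbrakk>retraction S g; finite F; \<And>s \<rho>. (s, \<rho>) \<in> F \<Longrightarrow> s \<in> S \<and> \<rho> *W t \<notin> S\<rbrakk> \<Longrightarrow>
      \<exists>x. (\<forall>\<rho>. \<rho> *W t \<in> S \<longrightarrow> g (\<rho> *W t) = \<rho> *V x) \<and> (\<forall>(s, \<rho>)\<in>F. g s + \<rho> *V x \<noteq> 0)"
  shows "separably_retractable (adjoin S t)"
  unfolding separably_retractable_def
proof (intro conjI allI impI)
  have sub: "W.subspace S" and range: "range h \<subseteq> S" and SN: "S \<subseteq> N"
    using S by (auto simp: separably_retractable_def)
  show "W.subspace (adjoin S t)" by (rule subspace_adjoin[OF sub])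
  show "range h \<subseteq> adjoin S t" using range subset_adjoin by blast
  show "adjoin S t \<subseteq> N" by (rule adjoin_subset[OF subspace_N SN \<open>t \<in> N\<close>])
  fix F assume "finite F \<and> F \<subseteq> adjoin S t - {0}"
  then have F: "finite F" "F \<subseteq> adjoin S t" "0 \<notin> F" by auto
  have "\<forall>y\<in>F. \<exists>p. fst p \<in> S \<and> y = fst p + snd p *W t"
  proof
    fix y assume "y \<in> F"
    then obtain s \<rho> where "s \<in> S" "y = s + \<rho> *W t" using F(2) adjoinE by blast
    then show "\<exists>p. fst p \<in> S \<and> y = fst p + snd p *W t" by (intro exI[of _ "(s, \<rho>)"]) simp
  qed
  from bchoice[OF this] obtain p
    where p: "\<And>y. y \<in> F \<Longrightarrow> fst (p y) \<in> S \<and> y = fst (p y) + snd (p y) *W t"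
    by (elim exE) blast
  have "finite (F \<inter> S)" "F \<inter> S \<subseteq> S - {0}" using F by auto
  then obtain g where g: "retraction S g" "\<forall>y\<in>F \<inter> S. g y \<noteq> 0"
    by (rule separably_retractableE[OF S])
  have "s \<in> S \<and> \<rho> *W t \<notin> S" if "(s, \<rho>) \<in> p ` (F - S)" for s \<rho>
  proof -
    from that obtain y where y: "y \<in> F" "y \<notin> S" "p y = (s, \<rho>)" by auto
    then have "s \<in> S" "y = s + \<rho> *W t"
      using p[OF y(1), unfolded y(3) fst_conv snd_conv] by blast+
    then show ?thesis using y(2) W.subspace_add[OF sub] by blast
  qed
  then obtain x where x: "\<And>\<rho>. \<rho> *W t \<in> S \<Longrightarrow> g (\<rho> *W t) = \<rho> *V x"
    and avoid: "\<forall>(s, \<rho>)\<in>p ` (F - S). g s + \<rho> *V x \<noteq> 0"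
    using witness[OF g(1), of "p ` (F - S)"] F(1) by blast
  obtain g' where g': "retraction (adjoin S t) g'"
      "\<And>s \<rho>. s \<in> S \<Longrightarrow> g' (s + \<rho> *W t) = g s + \<rho> *V x"
    using extend_retraction[OF sub range g(1) x] by blast
  have "g' y \<noteq> 0" if y: "y \<in> F" for y
  proof (cases "y \<in> S")
    case True
    then show ?thesis using g'(2)[of y 0] g(2) y by simp
  next
    case False
    obtain s \<rho> where p_y: "p y = (s, \<rho>)" by fastforce
    then have "(s, \<rho>) \<in> p ` (F - S)" using False y by (metis DiffI imageI)
    then have "g s + \<rho> *V x \<noteq> 0" using avoid by blast
    moreover have "s \<in> S" "y = s + \<rho> *W t"
      using p[OF y, unfolded p_y fst_conv snd_conv] by blast+
    ultimately show ?thesis using g'(2) by simp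
  qed
  with g'(1) show "\<exists>g. retraction (adjoin S t) g \<and> (\<forall>y\<in>F. g y \<noteq> 0)" by blast
qed

text \<open>The image and fibre conditions enter here. The fibre over \<open>v = g (f t)\<close> is infinite if \<open>v\<close> is,
  up to an element of \<open>f V\<close>, killed by \<open>f ^ (c(f) - 1)\<close>. This holds because
  \<open>f ^ (c(f) - 1) v = g (f ^ c(f) t)\<close> lies in \<open>f ^ c(f) V\<close>, which follows from the local description of
  torsion elements. Without torsion the argument fails: \<open>f ^ c(f) t\<close> could be a new element whose image
  under \<open>g\<close> is not divisible by \<open>f\<close>.\<close>

lemma infinite_fibre_retraction:
  assumes S: "W.subspace S" "range h \<subseteq> S" and g: "retraction S g"
    and f: "f \<in> monic_irreducibles" and t: "t \<in> torsion" "t \<notin> S" "f *W t \<in> S"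
  shows "infinite {x. f *V x = g (f *W t)}"
proof (cases "c f = \<infinity>")
  case True
  then show ?thesis by (rule infinite_fibre_infinite[OF f])
next
  case False
  then have fin: "c f < \<infinity>" by simp
  let ?n = "the_enat (c f)"
  have irr: "irreducible f" by (rule monic_irreducibleD(1)[OF f])
  obtain \<sigma> v where \<sigma>: "\<not> f dvd \<sigma>" and v: "f ^ ?n *W \<sigma> *W t = h (f ^ ?n *V v)"
    using torsion_local[OF f fin t(1)] .
  \<comment> \<open>If \<open>c(f) = 0\<close>, then \<open>\<sigma> t\<close> and \<open>f t\<close> are both in \<open>S\<close>, hence so is \<open>t\<close>.\<close>
  have n0: "?n \<noteq> 0"
  proof
    assume "?n = 0"
    then have "\<sigma> *W t \<in> S" using v S(2) by auto
    moreover obtain a b where "a * f + b * \<sigma> = 1" using irreducible_bezout[OF irr \<sigma>] .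
    then have "t = a *W f *W t + b *W \<sigma> *W t" by (simp flip: W.scale_left_distrib)
    ultimately show False using t S(1) by (metis W.subspace_add W.subspace_scale)
  qed
  then have fn: "f ^ ?n = f ^ (?n - 1) * f" by (metis mult.commute power_eq_if)
  have ftn: "f ^ ?n *W t \<in> S"
    using W.subspace_scale[OF S(1) t(3), of "f ^ (?n - 1)"] by (simp add: fn)
  \<comment> \<open>Since \<open>\<sigma>\<close> is invertible modulo \<open>f ^ n\<close>, divisibility of \<open>\<sigma> w\<close> by \<open>f ^ n\<close> passes to \<open>w\<close>.\<close>
  obtain a b where ab: "a * f ^ ?n + b * \<sigma> = 1" using irreducible_power_bezout[OF irr \<sigma>] by blast
  define w where "w = g (f ^ ?n *W t)"
  have "\<sigma> *V w = g (f ^ ?n *W \<sigma> *W t)"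
    using retractionD(2)[OF g ftn, of \<sigma>] by (simp add: w_def mult.commute)
  also have "\<dots> = f ^ ?n *V v" by (simp only: v retractionD(3)[OF g])
  finally have \<sigma>w: "\<sigma> *V w = f ^ ?n *V v" .
  define y where "y = a *V w + b *V v"
  have "w = (a * f ^ ?n + b * \<sigma>) *V w" by (simp add: ab)
  also have "\<dots> = a *V f ^ ?n *V w + b *V \<sigma> *V w" by (simp add: V.scale_left_distrib)
  also have "\<dots> = f ^ ?n *V y"
    unfolding \<sigma>w y_def by (simp add: V.scale_right_distrib mult_ac)
  finally have w: "w = f ^ ?n *V y" .
  have "f ^ (?n - 1) *V g (f *W t) = w"
    unfolding w_def fn using retractionD(2)[OF g t(3), of "f ^ (?n - 1)"] by simp
  then have "f ^ (?n - 1) *V (g (f *W t) - f *V y) = f ^ ?n *V y - (f ^ (?n - 1) * f) *V y"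
    by (simp add: w V.scale_right_diff_distrib)
  then have "f ^ (?n - 1) *V (g (f *W t) - f *V y) = 0"
    by (simp only: fn[symmetric] diff_self)
  moreover have "0 < c f" using n0 by (metis gr_zeroI the_enat.simps zero_enat_def)
  ultimately have "infinite {x. f *V x = g (f *W t) - f *V y}"
    using infinite_fibre_finite[OF f _ fin] by blast
  then have "infinite ((+) y ` {x. f *V x = g (f *W t) - f *V y})"
    by (simp add: finite_image_iff)
  moreover have "(+) y ` {x. f *V x = g (f *W t) - f *V y} \<subseteq> {x. f *V x = g (f *W t)}"
    by (auto simp: V.scale_right_distrib)
  ultimately show ?thesis using finite_subset by blast
qed

text \<open>Elements \<open>s + \<rho> t\<close> outside \<open>S\<close> have \<open>\<rho>\<close> prime to \<open>f\<close>. By a Bezout relation, at most one \<open>x\<close> in the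
  fibre of \<open>f\<close> maps such an element to zero, so an infinite fibre leaves room.\<close>

lemma separably_retractable_adjoin_irreducible:
  assumes S: "separably_retractable S"
    and f: "f \<in> monic_irreducibles" and t: "t \<in> torsion" "t \<notin> S" "f *W t \<in> S"
  shows "separably_retractable (adjoin S t)"
proof (rule separably_retractable_adjoin[OF S])
  show "t \<in> N" using t(1) by (simp add: torsion_def)
  have sub: "W.subspace S" and range: "range h \<subseteq> S"
    using S by (auto simp: separably_retractable_def)
  have irr: "irreducible f" by (rule monic_irreducibleD(1)[OF f])
  fix g F assume g: "retraction S g" and F: "finite F"
    and FS: "\<And>s \<rho>. (s, \<rho>) \<in> F \<Longrightarrow> s \<in> S \<and> \<rho> *W t \<notin> S"
  define bad where "bad p = {x. f *V x = g (f *W t) \<and> g (fst p) + snd p *V x = 0}" for p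
  have "finite (bad p)" if p: "p \<in> F" for p
  proof -
    have "\<not> f dvd snd p"
    proof
      assume "f dvd snd p"
      then have "snd p *W t \<in> S"
        using W.subspace_scale[OF sub t(3)] by (auto simp: dvd_def mult.commute)
      with FS[of "fst p" "snd p"] p show False by simp
    qed
    then obtain a b where ab: "a * f + b * snd p = 1" using irreducible_bezout[OF irr] by blast
    have "x = a *V g (f *W t) - b *V g (fst p)" if "x \<in> bad p" for x
    proof -
      from that have *: "f *V x = g (f *W t)" "snd p *V x = - g (fst p)"
        by (auto simp: bad_def eq_neg_iff_add_eq_0 add.commute)
      have "x = a *V f *V x + b *V snd p *V x"
        using ab by (simp flip: V.scale_left_distrib)
      then show ?thesis by (simp only: * V.scale_minus_right diff_conv_add_uminus)
    qed
    then have "bad p \<subseteq> {a *V g (f *W t) - b *V g (fst p)}" by blast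
    then show ?thesis by (rule finite_subset) simp
  qed
  then have "finite (\<Union>p\<in>F. bad p)" using F by blast
  then have "infinite ({x. f *V x = g (f *W t)} - (\<Union>p\<in>F. bad p))"
    using infinite_fibre_retraction[OF sub range g f t] by simp
  then obtain x where x: "f *V x = g (f *W t)" "x \<notin> (\<Union>p\<in>F. bad p)"
    using infinite_imp_nonempty by blast
  have "g (\<rho> *W t) = \<rho> *V x" if \<rho>: "\<rho> *W t \<in> S" for \<rho>
  proof -
    have "f dvd \<rho>"
    proof (rule ccontr)
      assume "\<not> f dvd \<rho>"
      then obtain a b where "a * f + b * \<rho> = 1" using irreducible_bezout[OF irr] by blast
      then have "t = a *W f *W t + b *W \<rho> *W t" by (simp flip: W.scale_left_distrib)
      then show False using t \<rho> sub by (metis W.subspace_add W.subspace_scale)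
    qed
    then obtain \<sigma> where \<sigma>: "\<rho> = \<sigma> * f" by (auto simp: dvd_def mult.commute)
    have "g (\<sigma> *W f *W t) = \<sigma> *V f *V x" using retractionD(2)[OF g t(3)] x(1) by simp
    then show ?thesis by (simp add: \<sigma>)
  qed
  moreover have "\<forall>(s, \<rho>)\<in>F. g s + \<rho> *V x \<noteq> 0"
    using x by (auto simp: bad_def)
  ultimately show "\<exists>x. (\<forall>\<rho>. \<rho> *W t \<in> S \<longrightarrow> g (\<rho> *W t) = \<rho> *V x) \<and>
      (\<forall>(s, \<rho>)\<in>F. g s + \<rho> *V x \<noteq> 0)" by blast
qed

lemma separably_retractable_adjoin_free:
  assumes S: "separably_retractable S" and t: "t \<in> N" "\<And>\<rho>. \<rho> *W t \<in> S \<Longrightarrow> \<rho> = 0"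
  shows "separably_retractable (adjoin S t)"
proof (rule separably_retractable_adjoin[OF S t(1)])
  have S0: "0 \<in> S" using S W.subspace_0 by (simp add: separably_retractable_def)
  fix g F assume g: "retraction S g" and F: "finite F"
    and FS: "\<And>s \<rho>. (s, \<rho>) \<in> F \<Longrightarrow> s \<in> S \<and> \<rho> *W t \<notin> S"
  \<comment> \<open>A free element has no annihilator, so the bounded case is impossible.\<close>
  have "\<not> (\<exists>\<mu>. \<mu> \<noteq> 0 \<and> (\<forall>y\<in>N. \<mu> *W y = 0))"
  proof
    assume "\<exists>\<mu>. \<mu> \<noteq> 0 \<and> (\<forall>y\<in>N. \<mu> *W y = 0)"
    then obtain \<mu> where "\<mu> \<noteq> 0" "\<mu> *W t = 0" using t(1) by blast
    then show False using t(2)[of \<mu>] S0 by simp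
  qed
  then have generic: "\<forall>F. finite F \<and> (\<forall>(\<rho>, u)\<in>F. \<rho> \<noteq> 0) \<longrightarrow> (\<exists>x. \<forall>(\<rho>, u)\<in>F. \<rho> *V x \<noteq> u)"
    using bounded_or_generic by blast
  have "\<forall>(\<rho>, u)\<in>(\<lambda>(s, \<rho>). (\<rho>, - g s)) ` F. \<rho> \<noteq> 0"
    using FS S0 by fastforce
  from generic[THEN spec, THEN mp, OF conjI[OF finite_imageI[OF F] this]]
  obtain x where "\<forall>(\<rho>, u)\<in>(\<lambda>(s, \<rho>). (\<rho>, - g s)) ` F. \<rho> *V x \<noteq> u" by blast
  then have "\<forall>(s, \<rho>)\<in>F. g s + \<rho> *V x \<noteq> 0"
    by (auto simp: eq_neg_iff_add_eq_0 add.commute)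
  moreover have "\<forall>\<rho>. \<rho> *W t \<in> S \<longrightarrow> g (\<rho> *W t) = \<rho> *V x"
    using t(2) retractionD(4)[OF g] by fastforce
  ultimately show "\<exists>x. (\<forall>\<rho>. \<rho> *W t \<in> S \<longrightarrow> g (\<rho> *W t) = \<rho> *V x) \<and>
      (\<forall>(s, \<rho>)\<in>F. g s + \<rho> *V x \<noteq> 0)" by blast
qed

text \<open>Split off one irreducible factor of \<open>\<rho>\<close> at a time, so that every single step adjoins
  an element \<open>t\<close> with \<open>f t\<close> already present.\<close>

lemma separably_retractable_insert_torsion:
  assumes "separably_retractable S" "S \<subseteq> torsion" "t \<in> N" "\<rho> \<noteq> 0" "\<rho> *W t \<in> S"
  shows "\<exists>S'. separably_retractable S' \<and> S \<subseteq> S' \<and> S' \<subseteq> torsion \<and> t \<in> S'"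
  using assms
proof (induction "degree \<rho>" arbitrary: \<rho> S rule: less_induct)
  case less
  have sub: "W.subspace S" using less.prems by (simp add: separably_retractable_def)
  show ?case
  proof (cases "degree \<rho> = 0")
    case True
    then have "\<rho> dvd 1" using less.prems(4) by (simp add: is_unit_iff_degree)
    then obtain \<sigma> where "1 = \<sigma> * \<rho>" by (auto simp: dvd_def mult.commute)
    then have "t = \<sigma> *W \<rho> *W t" by (metis W.scale_one W.scale_scale)
    then have "t \<in> S" using W.subspace_scale[OF sub less.prems(5)] by metis
    then show ?thesis using less.prems by blast
  next
    case False
    then obtain f where f: "f \<in> monic_irreducibles" "f dvd \<rho>"
      using ex_monic_irreducible_dvd by blast
    then obtain \<sigma> where \<sigma>: "\<rho> = f * \<sigma>" by blast
    then have nz: "f \<noteq> 0" "\<sigma> \<noteq> 0" using less.prems(4) by auto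
    then have deg: "degree \<sigma> < degree \<rho>"
      using monic_irreducibleD(3)[OF f(1)] by (simp add: \<sigma> degree_mult_eq)
    have "t \<in> torsion" using torsion_saturated less.prems by blast
    then have st: "\<sigma> *W t \<in> torsion" by (rule W.subspace_scale[OF subspace_torsion])
    obtain S1 where S1: "separably_retractable S1" "S \<subseteq> S1" "S1 \<subseteq> torsion" "\<sigma> *W t \<in> S1"
    proof (cases "\<sigma> *W t \<in> S")
      case True
      then show thesis using that less.prems by blast
    next
      case not_in: False
      show thesis
      proof (rule that)
        show "separably_retractable (adjoin S (\<sigma> *W t))"
          using less.prems st not_in f(1) \<sigma>
          by (intro separably_retractable_adjoin_irreducible[of S f]) auto
        show "adjoin S (\<sigma> *W t) \<subseteq> torsion"
          using adjoin_subset subspace_torsion less.prems(2) st by blast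
      qed (simp_all add: subset_adjoin mem_adjoin sub)
    qed
    from less.hyps[OF deg S1(1,3) less.prems(3) nz(2) S1(4)] S1(2) show ?thesis by blast
  qed
qed

text \<open>The Euclidean algorithm on the coefficients. As long as two coefficients are nonzero, replacing
  \<open>\<rho>\<^sub>i\<close> by \<open>\<rho>\<^sub>i mod \<rho>\<^sub>j\<close> and \<open>b\<^sub>j\<close> by \<open>b\<^sub>j + (\<rho>\<^sub>i div \<rho>\<^sub>j) b\<^sub>i\<close> keeps the value of the relation and
  the module generated by the family. At the end a single \<open>\<rho>\<^sub>k b\<^sub>k\<close> is torsion, and so is \<open>b\<^sub>k\<close>.\<close>

lemma relation_reduction:
  assumes "finite I" and "\<And>i. i \<in> I \<Longrightarrow> b i \<in> N"
    and "(\<Sum>i\<in>I. \<rho> i *W b i) \<in> torsion" and "\<exists>i\<in>I. \<rho> i \<noteq> 0"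
  shows "\<exists>b' k. k \<in> I \<and> b' k \<in> torsion \<and> (\<forall>i\<in>I. b' i \<in> N) \<and>
    (\<forall>S. W.subspace S \<longrightarrow> (\<forall>i\<in>I. b' i \<in> S) \<longrightarrow> (\<forall>i\<in>I. b i \<in> S))"
  using assms(2-)
proof (induction "\<Sum>i\<in>I. if \<rho> i = 0 then 0 else Suc (degree (\<rho> i))" arbitrary: \<rho> b rule: less_induct)
  case less
  from less.prems(3) obtain k where k: "k \<in> I" "\<rho> k \<noteq> 0" by blast
  show ?case
  proof (cases "\<exists>i\<in>I. i \<noteq> k \<and> \<rho> i \<noteq> 0")
    case False
    then have "(\<Sum>i\<in>I - {k}. \<rho> i *W b i) = 0" by (intro sum.neutral) auto
    then have "(\<Sum>i\<in>I. \<rho> i *W b i) = \<rho> k *W b k"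
      by (simp add: sum.remove[OF \<open>finite I\<close> k(1)])
    then have "b k \<in> torsion" using torsion_saturated k less.prems by metis
    then show ?thesis using k less.prems(1) by blast
  next
    case True
    then obtain k' where k': "k' \<in> I" "k' \<noteq> k" "\<rho> k' \<noteq> 0" by blast
    obtain i j where ij: "i \<in> I" "j \<in> I" "i \<noteq> j" "\<rho> i \<noteq> 0" "\<rho> j \<noteq> 0" "degree (\<rho> j) \<le> degree (\<rho> i)"
      using k k' by (metis nat_le_linear)
    define \<rho>' where "\<rho>' = \<rho>(i := \<rho> i mod \<rho> j)"
    define b' where "b' = b(j := b j + (\<rho> i div \<rho> j) *W b i)"
    note sum_I = sum_remove_two[OF \<open>finite I\<close> ij(1,2,3)]
    have rest: "(\<Sum>l\<in>I - {i, j}. \<rho>' l *W b' l) = (\<Sum>l\<in>I - {i, j}. \<rho> l *W b l)"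
      by (rule sum.cong) (auto simp: \<rho>'_def b'_def)
    have "\<rho> i *W b i = (\<rho> i div \<rho> j * \<rho> j + \<rho> i mod \<rho> j) *W b i"
      by (simp only: div_mult_mod_eq)
    then have "\<rho> i *W b i + \<rho> j *W b j
        = (\<rho> i mod \<rho> j) *W b i + \<rho> j *W (b j + (\<rho> i div \<rho> j) *W b i)"
      by (simp only: W.scale_left_distrib W.scale_right_distrib W.scale_scale mult.commute ac_simps)
    then have "(\<Sum>l\<in>I. \<rho>' l *W b' l) = (\<Sum>l\<in>I. \<rho> l *W b l)"
      unfolding sum_I rest using ij(3) by (simp add: \<rho>'_def b'_def)
    then have tors: "(\<Sum>l\<in>I. \<rho>' l *W b' l) \<in> torsion" using less.prems(2) by simp
    have rest': "(\<Sum>l\<in>I - {i, j}. if \<rho>' l = 0 then 0 else Suc (degree (\<rho>' l)))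
        = (\<Sum>l\<in>I - {i, j}. if \<rho> l = 0 then 0 else Suc (degree (\<rho> l)))"
      by (rule sum.cong) (auto simp: \<rho>'_def)
    have "(if \<rho> i mod \<rho> j = 0 then 0 else Suc (degree (\<rho> i mod \<rho> j))) < Suc (degree (\<rho> i))"
      using degree_mod_less'[OF ij(5)] ij(6) by (auto intro: less_le_trans)
    then have decrease: "(\<Sum>l\<in>I. if \<rho>' l = 0 then 0 else Suc (degree (\<rho>' l)))
        < (\<Sum>l\<in>I. if \<rho> l = 0 then 0 else Suc (degree (\<rho> l)))"
      unfolding sum_I rest' using ij by (auto simp: \<rho>'_def)
    have b'N: "b' l \<in> N" if "l \<in> I" for l
      using less.prems(1) that ij(1) subspace_N
      by (auto simp: b'_def intro!: W.subspace_add W.subspace_scale)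
    have "\<exists>l\<in>I. \<rho>' l \<noteq> 0" using ij by (auto simp: \<rho>'_def)
    from less.hyps[OF decrease b'N tors this] obtain b'' k where b'': "k \<in> I" "b'' k \<in> torsion"
        "\<forall>i\<in>I. b'' i \<in> N" "\<And>S. W.subspace S \<Longrightarrow> \<forall>i\<in>I. b'' i \<in> S \<Longrightarrow> \<forall>i\<in>I. b' i \<in> S"
      by blast
    have "\<forall>l\<in>I. b l \<in> S" if S: "W.subspace S" "\<forall>i\<in>I. b'' i \<in> S" for S
    proof
      fix l assume l: "l \<in> I"
      have b': "\<forall>i\<in>I. b' i \<in> S" by (rule b''(4)[OF S])
      have "b i \<in> S" using b' ij by (auto simp: b'_def split: if_splits)
      moreover from b' ij have "b j + (\<rho> i div \<rho> j) *W b i \<in> S" by (auto simp: b'_def)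
      ultimately have "b j \<in> S"
        using S(1) by (metis W.subspace_diff W.subspace_scale add_diff_cancel)
      then show "b l \<in> S" using b' l by (cases "l = j") (auto simp: b'_def split: if_splits)
    qed
    with b'' show ?thesis by blast
  qed
qed

text \<open>The last conclusion bounds \<open>S'\<close> from above; it is what shows that the next element of the family is
  still free over the module built so far.\<close>

lemma separably_retractable_insert_independent:
  assumes "finite I" and S: "separably_retractable S" "S \<subseteq> torsion"
    and "\<And>i. i \<in> I \<Longrightarrow> b i \<in> N"
    and "\<And>\<rho>. (\<Sum>i\<in>I. \<rho> i *W b i) \<in> torsion \<Longrightarrow> \<forall>i\<in>I. \<rho> i = 0"
  shows "\<exists>S'. separably_retractable S' \<and> S \<subseteq> S' \<and> b ` I \<subseteq> S' \<and>
    (\<forall>y\<in>S'. \<exists>\<rho>. y - (\<Sum>i\<in>I. \<rho> i *W b i) \<in> S)"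
  using assms(1,4-)
proof (induction I)
  case empty
  then show ?case using S by auto
next
  case (insert k I)
  have sum_upd: "(\<Sum>i\<in>I. (\<rho>(k := \<tau>)) i *W b i) = (\<Sum>i\<in>I. \<rho> i *W b i)" for \<rho> \<tau>
    by (rule sum.cong) (use insert.hyps in auto)
  have "\<forall>i\<in>I. \<rho> i = 0" if "(\<Sum>i\<in>I. \<rho> i *W b i) \<in> torsion" for \<rho>
    using insert.prems(2)[of "\<rho>(k := 0)"] insert.hyps that sum_upd[of \<rho> 0] by (auto split: if_splits)
  from insert.IH[OF insert.prems(1)[OF insertI2] this]
  obtain S' where S': "separably_retractable S'" "S \<subseteq> S'" "b ` I \<subseteq> S'"
      "\<And>y. y \<in> S' \<Longrightarrow> \<exists>\<rho>. y - (\<Sum>i\<in>I. \<rho> i *W b i) \<in> S"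
    by blast
  have sub: "W.subspace S'" using S'(1) by (simp add: separably_retractable_def)
  have "\<tau> = 0" if \<tau>: "\<tau> *W b k \<in> S'" for \<tau>
  proof -
    from S'(4)[OF \<tau>] obtain \<rho> where "\<tau> *W b k - (\<Sum>i\<in>I. \<rho> i *W b i) \<in> S" by blast
    moreover have "\<tau> *W b k - (\<Sum>i\<in>I. \<rho> i *W b i)
        = (\<Sum>i\<in>insert k I. ((\<lambda>i. - \<rho> i)(k := \<tau>)) i *W b i)"
      using insert.hyps sum_upd[of "\<lambda>i. - \<rho> i" \<tau>] by (simp add: sum_negf)
    ultimately have "(\<Sum>i\<in>insert k I. ((\<lambda>i. - \<rho> i)(k := \<tau>)) i *W b i) \<in> torsion"
      using S(2) by auto
    from insert.prems(2)[OF this] show ?thesis by auto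
  qed
  then have "separably_retractable (adjoin S' (b k))"
    using separably_retractable_adjoin_free[OF S'(1)] insert.prems(1) by blast
  moreover have "S \<subseteq> adjoin S' (b k)" "b ` insert k I \<subseteq> adjoin S' (b k)"
    using S'(2,3) subset_adjoin mem_adjoin[OF sub] by blast+
  moreover have "\<exists>\<rho>. y - (\<Sum>i\<in>insert k I. \<rho> i *W b i) \<in> S" if "y \<in> adjoin S' (b k)" for y
  proof -
    from that obtain s \<tau> where s: "s \<in> S'" "y = s + \<tau> *W b k" by (elim adjoinE)
    then obtain \<rho> where "s - (\<Sum>i\<in>I. \<rho> i *W b i) \<in> S" using S'(4) by blast
    then have "y - (\<Sum>i\<in>insert k I. (\<rho>(k := \<tau>)) i *W b i) \<in> S"
      using s(2) insert.hyps sum_upd[of \<rho> \<tau>] by simp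
    then show ?thesis by blast
  qed
  ultimately show ?case by blast
qed

text \<open>Induction on the size of the family: each nontrivial relation modulo torsion trades one member for
  a torsion element, which is adjoined first; an independent family is adjoined freely.\<close>

lemma separably_retractable_insert_family:
  assumes "finite I" "separably_retractable S" "S \<subseteq> torsion" "\<And>i. i \<in> I \<Longrightarrow> b i \<in> N"
  shows "\<exists>S'. separably_retractable S' \<and> S \<subseteq> S' \<and> b ` I \<subseteq> S'"
  using assms
proof (induction "card I" arbitrary: I S b rule: less_induct)
  case less
  show ?case
  proof (cases "\<exists>\<rho>. (\<Sum>i\<in>I. \<rho> i *W b i) \<in> torsion \<and> (\<exists>i\<in>I. \<rho> i \<noteq> 0)")
    case False
    then have "\<forall>i\<in>I. \<rho> i = 0" if "(\<Sum>i\<in>I. \<rho> i *W b i) \<in> torsion" for \<rho>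
      using that by blast
    from separably_retractable_insert_independent[where b = b, OF less.prems this]
    show ?thesis by blast
  next
    case True
    then obtain b' k where b': "k \<in> I" "b' k \<in> torsion" "\<And>i. i \<in> I \<Longrightarrow> b' i \<in> N"
        "\<And>S. W.subspace S \<Longrightarrow> \<forall>i\<in>I. b' i \<in> S \<Longrightarrow> \<forall>i\<in>I. b i \<in> S"
    proof -
      from True obtain \<rho> where "(\<Sum>i\<in>I. \<rho> i *W b i) \<in> torsion" "\<exists>i\<in>I. \<rho> i \<noteq> 0" by blast
      from relation_reduction[where b = b, OF less.prems(1,4) this] that show ?thesis by blast
    qed
    obtain \<rho> where "\<rho> \<noteq> 0" "\<rho> *W b' k \<in> range h"
      using b'(2) by (auto simp only: torsion_def mem_Collect_eq)
    moreover have "range h \<subseteq> S" using less.prems by (simp add: separably_retractable_def)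
    ultimately obtain S1 where S1: "separably_retractable S1" "S \<subseteq> S1" "S1 \<subseteq> torsion" "b' k \<in> S1"
      using separably_retractable_insert_torsion[OF less.prems(2,3) b'(3)[OF b'(1)]] by blast
    have "card (I - {k}) < card I" using less.prems(1) b'(1) by (rule card_Diff1_less)
    then obtain S2 where S2: "separably_retractable S2" "S1 \<subseteq> S2" "b' ` (I - {k}) \<subseteq> S2"
      using less.hyps[OF _ _ S1(1,3), of "I - {k}" b'] less.prems(1) b'(3) by auto
    have "\<forall>i\<in>I. b' i \<in> S2" using S2 S1(4) by blast
    then have "\<forall>i\<in>I. b i \<in> S2" using b'(4) S2(1) by (simp add: separably_retractable_def)
    then show ?thesis using S1(2) S2 by blast
  qed
qed

theorem finite_subset_separably_retractable:
  assumes "finite B" "B \<subseteq> N"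
  obtains S where "separably_retractable S" "B \<subseteq> S"
  using separably_retractable_insert_family[OF assms(1) separably_retractable_range_h range_h_torsion,
      of "\<lambda>x. x"] assms(2) by auto

end

section \<open>Reflecting existential formulas along partial homomorphisms\<close>

text \<open>The structure on \<open>S\<close> is given by \<open>scaleW\<close> and \<open>\<eta>\<close>, which live on a larger space; nothing is said
  about \<open>g\<close> outside \<open>S\<close>.\<close>

definition partial_hom ::
    "('k::field \<Rightarrow> 'w::ab_group_add \<Rightarrow> 'w) \<Rightarrow> ('w \<Rightarrow> 'w) \<Rightarrow> 'w set \<Rightarrow>
     ('k \<Rightarrow> 'v::ab_group_add \<Rightarrow> 'v) \<Rightarrow> ('v \<Rightarrow> 'v) \<Rightarrow> ('w \<Rightarrow> 'v) \<Rightarrow> bool" where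
  "partial_hom scaleW \<eta> S scale \<theta> g \<longleftrightarrow>
     module.subspace scaleW S \<and> (\<forall>x\<in>S. \<eta> x \<in> S) \<and>
     (\<forall>x\<in>S. \<forall>y\<in>S. g (x + y) = g x + g y) \<and>
     (\<forall>a. \<forall>x\<in>S. g (scaleW a x) = scale a (g x)) \<and>
     (\<forall>x\<in>S. g (\<eta> x) = \<theta> (g x))"

text \<open>A homomorphism that keeps these elements nonzero preserves and reflects every atomic formula in \<open>\<phi>\<close>.\<close>

primrec atom_differences ::
    "('k \<Rightarrow> 'w::ab_group_add \<Rightarrow> 'w) \<Rightarrow> ('w \<Rightarrow> 'w) \<Rightarrow> (nat \<Rightarrow> 'w) \<Rightarrow> 'k fm \<Rightarrow> 'w set" where
  "atom_differences scale \<theta> e (Equal s t) = {tm_val scale \<theta> e s - tm_val scale \<theta> e t} - {0}"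
| "atom_differences scale \<theta> e (Neg \<phi>) = atom_differences scale \<theta> e \<phi>"
| "atom_differences scale \<theta> e (Conj \<phi> \<psi>) = atom_differences scale \<theta> e \<phi> \<union> atom_differences scale \<theta> e \<psi>"
| "atom_differences scale \<theta> e (Exi i \<phi>) = {}"

text \<open>The witnesses of the existential quantifiers are collected in \<open>B\<close>, the atom differences that occur
  with these witnesses in \<open>F\<close>. Both are fixed before \<open>S\<close> and \<open>g\<close> are chosen.\<close>

definition reflection_data ::
    "('k::field \<Rightarrow> 'w::ab_group_add \<Rightarrow> 'w) \<Rightarrow> ('w \<Rightarrow> 'w) \<Rightarrow> (nat \<Rightarrow> 'w) \<Rightarrow>
     ('k \<Rightarrow> 'v::ab_group_add \<Rightarrow> 'v) \<Rightarrow> ('v \<Rightarrow> 'v) \<Rightarrow> 'k fm \<Rightarrow> 'w set \<Rightarrow> 'w set \<Rightarrow> bool" where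
  "reflection_data scaleW \<eta> e scale \<theta> \<phi> B F \<longleftrightarrow>
     (\<forall>S g. partial_hom scaleW \<eta> S scale \<theta> g \<and> range e \<subseteq> S \<and> B \<subseteq> S \<longrightarrow>
        F \<subseteq> S - {0} \<and> ((\<forall>y\<in>F. g y \<noteq> 0) \<longrightarrow> sat scale UNIV \<theta> (g \<circ> e) \<phi>))"

lemma finite_atom_differences: "finite (atom_differences scale \<theta> e \<phi>)"
  by (induction \<phi>) simp_all

context
  fixes scaleW :: "'k::field \<Rightarrow> 'w::ab_group_add \<Rightarrow> 'w" and \<eta> :: "'w \<Rightarrow> 'w"
    and scale :: "'k \<Rightarrow> 'v::ab_group_add \<Rightarrow> 'v" and \<theta> :: "'v \<Rightarrow> 'v"
  assumes vsW: "vector_space scaleW" and vsV: "vector_space scale"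
begin

interpretation W: vector_space scaleW by (fact vsW)
interpretation V: vector_space scale by (fact vsV)

lemma partial_hom_zero_diff:
  assumes "partial_hom scaleW \<eta> S scale \<theta> g"
  shows "g 0 = 0" and "x \<in> S \<Longrightarrow> y \<in> S \<Longrightarrow> g (x - y) = g x - g y"
proof -
  have S: "W.subspace S" and add: "\<And>x y. x \<in> S \<Longrightarrow> y \<in> S \<Longrightarrow> g (x + y) = g x + g y"
    using assms by (auto simp: partial_hom_def)
  show "g 0 = 0" using add[of 0 0] W.subspace_0[OF S] by simp
  assume "x \<in> S" "y \<in> S"
  then show "g (x - y) = g x - g y"
    using add[of "x - y" y] W.subspace_diff[OF S] by simp
qed

lemma tm_val_partial_hom:
  assumes "partial_hom scaleW \<eta> S scale \<theta> g" and "range e \<subseteq> S"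
  shows "tm_val scaleW \<eta> e t \<in> S \<and> tm_val scale \<theta> (g \<circ> e) t = g (tm_val scaleW \<eta> e t)"
proof (induction t)
  case (Var i)
  then show ?case using assms(2) by auto
next
  case Zero
  then show ?case
    using assms(1) partial_hom_zero_diff(1)[OF assms(1)] W.subspace_0 by (auto simp: partial_hom_def)
qed (use assms(1) in \<open>auto simp: partial_hom_def W.subspace_add W.subspace_scale\<close>)

lemma quantifier_free_partial_hom:
  assumes g: "partial_hom scaleW \<eta> S scale \<theta> g" and e: "range e \<subseteq> S"
    and "quantifier_free \<phi>" and "\<forall>y\<in>atom_differences scaleW \<eta> e \<phi>. g y \<noteq> 0"
  shows "sat scaleW N \<eta> e \<phi> \<longleftrightarrow> sat scale UNIV \<theta> (g \<circ> e) \<phi>"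
  using assms(3,4)
proof (induction \<phi>)
  case (Equal s t)
  let ?s = "tm_val scaleW \<eta> e s" and ?t = "tm_val scaleW \<eta> e t"
  have "g (?s - ?t) = g ?s - g ?t"
    using partial_hom_zero_diff(2)[OF g] tm_val_partial_hom[OF g e] by blast
  then show ?case
    using Equal.prems(2) tm_val_partial_hom[OF g e, of s] tm_val_partial_hom[OF g e, of t]
    by (cases "?s = ?t") (simp_all del: o_apply comp_apply)
qed auto

lemma atom_differences_subset:
  assumes g: "partial_hom scaleW \<eta> S scale \<theta> g" and e: "range e \<subseteq> S"
  shows "atom_differences scaleW \<eta> e \<phi> \<subseteq> S - {0}"
proof (induction \<phi>)
  case (Equal s t)
  have "W.subspace S" using g by (simp add: partial_hom_def)
  then show ?case using tm_val_partial_hom[OF g e] W.subspace_diff by auto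
qed auto

lemma existential_partial_hom:
  assumes "existential \<phi>" and "sat scaleW N \<eta> e \<phi>"
  shows "\<exists>B F. finite B \<and> B \<subseteq> N \<and> finite F \<and> reflection_data scaleW \<eta> e scale \<theta> \<phi> B F"
  using assms
proof (induction \<phi> arbitrary: e rule: existential.induct)
  case (1 \<phi>)
  have "reflection_data scaleW \<eta> e scale \<theta> \<phi> {} (atom_differences scaleW \<eta> e \<phi>)"
    unfolding reflection_data_def
  proof (intro allI impI conjI; elim conjE)
    fix S g assume g: "partial_hom scaleW \<eta> S scale \<theta> g" "range e \<subseteq> S"
    show "atom_differences scaleW \<eta> e \<phi> \<subseteq> S - {0}" by (rule atom_differences_subset[OF g])
    assume "\<forall>y\<in>atom_differences scaleW \<eta> e \<phi>. g y \<noteq> 0"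
    from quantifier_free_partial_hom[OF g "1.hyps" this] "1.prems"
    show "sat scale UNIV \<theta> (g \<circ> e) \<phi>" by blast
  qed
  then show ?case using finite_atom_differences by blast
next
  case (2 \<phi> i)
  from "2.prems" obtain a where a: "a \<in> N" "sat scaleW N \<eta> (e(i := a)) \<phi>" by auto
  from "2.IH"[OF a(2)] obtain B F where BF: "finite B" "B \<subseteq> N" "finite F"
    and refl: "reflection_data scaleW \<eta> (e(i := a)) scale \<theta> \<phi> B F" by blast
  have "reflection_data scaleW \<eta> e scale \<theta> (Exi i \<phi>) (insert a B) F"
    unfolding reflection_data_def
  proof (intro allI impI conjI; elim conjE)
    fix S g assume g: "partial_hom scaleW \<eta> S scale \<theta> g" "range e \<subseteq> S" "insert a B \<subseteq> S"
    then have "range (e(i := a)) \<subseteq> S" "B \<subseteq> S" by auto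
    with g(1) refl have *: "F \<subseteq> S - {0}"
      "(\<forall>y\<in>F. g y \<noteq> 0) \<longrightarrow> sat scale UNIV \<theta> (g \<circ> e(i := a)) \<phi>"
      unfolding reflection_data_def by blast+
    show "F \<subseteq> S - {0}" by (rule *(1))
    assume "\<forall>y\<in>F. g y \<noteq> 0"
    with *(2) have "sat scale UNIV \<theta> ((g \<circ> e)(i := g a)) \<phi>" by (simp add: fun_upd_comp)
    then show "sat scale UNIV \<theta> (g \<circ> e) (Exi i \<phi>)" by auto
  qed
  then show ?case using a(1) BF by (intro exI[of _ "insert a B"] exI[of _ F]) simp
qed

end

text \<open>A separably retractable submodule containing all witnesses has a retraction that keeps the relevant
  atom differences nonzero, and it transports the formula from the extension to \<open>V\<close>.\<close>

proposition C_complete_imp_existentially_closed: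
  fixes C :: "'k::field kconf"
    and scale :: "'k \<Rightarrow> 'v::ab_group_add \<Rightarrow> 'v" and scaleW :: "'k \<Rightarrow> 'w::ab_group_add \<Rightarrow> 'w"
  assumes C: "kernel_configuration C" and vs: "vector_space scale"
    and complete: "C_complete C scale UNIV \<theta>"
  shows "existentially_closed scaleW C scale UNIV \<theta>"
  unfolding existentially_closed_def
proof (intro allI impI; elim conjE)
  fix N \<eta> h \<phi> e
  assume N: "models_T C scaleW N \<eta>" and h: "embedding scale UNIV \<theta> scaleW N \<eta> h"
    and \<phi>: "existential \<phi>" and sat: "sat scaleW N \<eta> (h \<circ> e) \<phi>"
  have vsW: "vector_space scaleW" and sub: "module.subspace scaleW N"
    and endoN: "endomorphism_on scaleW N \<eta>" and CN: "C_endomorphism C scaleW N \<eta>"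
    using N by (auto simp: models_T_def C_endomorphism_def)
  have endo: "endomorphism_on scale UNIV \<theta>"
    using complete by (simp add: C_complete_def C_endomorphism_def)
  obtain \<eta>' where \<eta>': "endomorphism_on scaleW UNIV \<eta>'" "\<And>x. x \<in> N \<Longrightarrow> \<eta>' x = \<eta> x"
    using extend_endomorphism[OF vsW sub endoN] by blast
  have \<eta>N: "\<eta> x \<in> N" if "x \<in> N" for x using endoN that by (simp add: endomorphism_on_def)
  have poly\<eta>': "poly_endo scaleW \<rho> \<eta>' x = poly_endo scaleW \<rho> \<eta> x" if "x \<in> N" for \<rho> x
    by (rule poly_endo_cong[OF \<eta>'(2) \<eta>N that])
  define sv where "sv = (\<lambda>\<rho>. poly_endo scale \<rho> \<theta>)"
  define sw where "sw = (\<lambda>\<rho>. poly_endo scaleW \<rho> \<eta>')"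
  have mod_v: "module sv" unfolding sv_def by (rule module_poly_endo[OF vs endo])
  have mod_w: "module sw" unfolding sw_def by (rule module_poly_endo[OF vsW \<eta>'(1)])
  interpret V: module sv by (rule mod_v)
  interpret W: module sw by (rule mod_w)
  have subN: "W.subspace N"
    using subspace_poly_endo_iff[OF vsW \<eta>'(1), of N] sub \<eta>N \<eta>'(2) by (simp add: sw_def)
  have h_hom: "h (x + y) = h x + h y" "h (scale a x) = scaleW a (h x)" "h (\<theta> x) = \<eta>' (h x)"
    and hN: "range h \<subseteq> N" and inj: "inj h" for x y a
    using h \<eta>'(2) by (auto simp: embedding_def image_subset_iff)
  interpret complete_module_extension sv sw h N "fst C"
  proof
    show "h (sv \<rho> x) = sw \<rho> (h x)" for \<rho> x
      unfolding sv_def sw_def using h_hom by (intro poly_endo_hom[symmetric]) auto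
  next
    fix f y assume f: "f \<in> monic_irreducibles" "fst C f < \<infinity>" and y: "y \<in> N"
      and ker: "sw (f ^ (the_enat (fst C f) + 1)) y = 0"
    show "sw (f ^ the_enat (fst C f)) y = 0"
    proof (cases "algebraic C")
      case True
      then have "sw (MiPo C) y = 0" using CN y by (simp add: C_endomorphism_def sw_def poly\<eta>')
      then show ?thesis by (rule monic_irreducible_kernel_stable[OF C True f(1) mod_w _ ker])
    next
      case False
      then have "Ker_on scaleW N \<eta> (f ^ the_enat (fst C f))
          = Ker_on scaleW N \<eta> (f ^ (the_enat (fst C f) + 1))"
        using CN f by (simp add: C_endomorphism_def algebraic_def transcendental_def)
      then show ?thesis using ker y by (auto simp: Ker_on_def sw_def poly\<eta>')
    qed
  next
    fix f x assume "f \<in> monic_irreducibles" "fst C f < \<infinity>"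
    then have "Im_on scale UNIV \<theta> (f ^ the_enat (fst C f))
        = Im_on scale UNIV \<theta> (f ^ (the_enat (fst C f) + 1))"
      using complete by (simp add: C_complete_def)
    then show "\<exists>z. sv (f ^ the_enat (fst C f)) x = sv (f ^ (the_enat (fst C f) + 1)) z"
      unfolding Im_on_def sv_def by blast
  next
    fix f u assume "f \<in> monic_irreducibles" "0 < fst C f" "fst C f < \<infinity>"
      and "sv (f ^ (the_enat (fst C f) - 1)) u = 0"
    then show "infinite {x. sv f x = u}"
      using complete by (simp add: C_complete_def Ker_on_def sv_def)
  next
    fix f u assume "f \<in> monic_irreducibles" "fst C f = \<infinity>"
    then show "infinite {x. sv f x = u}"
      using complete by (simp add: C_complete_def sv_def)
  next
    show "(\<exists>\<mu>. \<mu> \<noteq> 0 \<and> (\<forall>y\<in>N. sw \<mu> y = 0)) \<or>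
      (\<forall>F. finite F \<and> (\<forall>(\<rho>, u)\<in>F. \<rho> \<noteq> 0) \<longrightarrow> (\<exists>x. \<forall>(\<rho>, u)\<in>F. sv \<rho> x \<noteq> u))"
    proof (cases "algebraic C")
      case True
      then have "\<forall>y\<in>N. sw (MiPo C) y = 0" using CN by (simp add: C_endomorphism_def sw_def poly\<eta>')
      then show ?thesis using MiPo_nonzero by blast
    next
      case False
      then have *: "\<And>F. finite F \<and> F \<subseteq> {(\<rho>, u). \<rho> \<noteq> 0 \<and> u \<in> UNIV} \<Longrightarrow>
          \<exists>x\<in>UNIV. \<forall>(\<rho>, u)\<in>F. poly_endo scale \<rho> \<theta> x \<noteq> u"
        using complete unfolding C_complete_def algebraic_def transcendental_def by auto
      have "\<exists>x. \<forall>(\<rho>, u)\<in>F. sv \<rho> x \<noteq> u" if "finite F" "\<forall>(\<rho>, u)\<in>F. \<rho> \<noteq> 0" for F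
        using *[of F] that unfolding sv_def by auto
      then show ?thesis by blast
    qed
  qed (fact h_hom(1) inj hN subN)+
  obtain B F where BF: "finite B" "B \<subseteq> N" "finite F"
    and reflect: "reflection_data scaleW \<eta> (h \<circ> e) scale \<theta> \<phi> B F"
    using existential_partial_hom[OF vsW vs \<phi> sat] by blast
  obtain S where S: "separably_retractable S" "B \<subseteq> S"
    using finite_subset_separably_retractable[OF BF(1,2)] .
  have S': "W.subspace S" "range h \<subseteq> S" "S \<subseteq> N" using S(1) by (auto simp: separably_retractable_def)
  have closed: "module.subspace scaleW S" "\<And>x. x \<in> S \<Longrightarrow> \<eta>' x \<in> S"
    using subspace_poly_endo_iff[OF vsW \<eta>'(1), of S] S'(1) by (auto simp: sw_def)
  have hom: "partial_hom scaleW \<eta> S scale \<theta> g" if g: "retraction S g" for g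
    unfolding partial_hom_def
  proof (intro conjI ballI allI)
    fix x assume x: "x \<in> S"
    have \<eta>x: "\<eta>' x = \<eta> x" using \<eta>'(2) x S'(3) by blast
    show "\<eta> x \<in> S" using closed(2)[OF x] by (simp add: \<eta>x)
    show "g (\<eta> x) = \<theta> (g x)"
      using retractionD(2)[OF g x, of "[:0, 1:]"]
      by (simp add: sw_def sv_def poly_endo_X[OF vsW] poly_endo_X[OF vs] \<eta>x)
    show "g (scaleW a x) = scale a (g x)" for a
      using retractionD(2)[OF g x, of "[:a:]"] by (simp add: sw_def sv_def poly_endo_const)
    show "g (x + y) = g x + g y" if "y \<in> S" for y using retractionD(1)[OF g x that] .
  qed (rule closed(1))
  have he: "range (h \<circ> e) \<subseteq> S" using S'(2) by auto
  obtain g0 where g0: "retraction S g0"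
    by (rule separably_retractableE[OF S(1) finite.emptyI empty_subsetI])
  with reflect hom he S(2) have "F \<subseteq> S - {0}" unfolding reflection_data_def by blast
  then obtain g where g: "retraction S g" "\<forall>y\<in>F. g y \<noteq> 0"
    by (rule separably_retractableE[OF S(1) BF(3)])
  have "sat scale UNIV \<theta> (g \<circ> (h \<circ> e)) \<phi>"
    using reflect hom[OF g(1)] he S(2) g(2) unfolding reflection_data_def by blast
  moreover have "g \<circ> (h \<circ> e) = e" using retractionD(3)[OF g(1)] by (simp add: fun_eq_iff)
  ultimately show "sat scale UNIV \<theta> e \<phi>" by simp
qed

section \<open>Embedding small vector spaces\<close>

text \<open>Thin the spanning set \<open>G\<close> out to a basis and send it injectively into the independent set \<open>B\<close>.\<close>

lemma ex_linear_injection: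
  assumes "vector_space s1" "vector_space s2"
    and G: "module.span s1 G = UNIV" and B: "\<not> module.dependent s2 B" and le: "G \<lesssim> B"
  obtains j where "Vector_Spaces.linear s1 s2 j" "inj j"
proof -
  interpret V1: vector_space s1 by fact
  interpret V2: vector_space s2 by fact
  interpret vector_space_pair s1 s2 ..
  obtain Q where Q: "Q \<subseteq> G" "V1.independent Q" "G \<subseteq> V1.span Q"
    by (rule V1.maximal_independent_subset)
  have span: "V1.span Q = UNIV"
    using V1.span_minimal[OF Q(3) V1.subspace_span] G by auto
  obtain \<phi> where \<phi>: "inj_on \<phi> G" "\<phi> ` G \<subseteq> B" using le unfolding lepoll_def by blast
  define j where "j = construct Q \<phi>"
  have lin: "Vector_Spaces.linear s1 s2 j" unfolding j_def by (rule linear_construct[OF Q(2)])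
  interpret j: Vector_Spaces.linear s1 s2 j by (rule lin)
  have j: "j b = \<phi> b" if "b \<in> Q" for b
    unfolding j_def by (rule construct_basis[OF Q(2) that])
  have "j ` Q \<subseteq> B" using j Q(1) \<phi>(2) by fastforce
  then have "V2.independent (j ` Q)" using V2.independent_mono[OF B] by blast
  moreover have "inj_on j Q"
    using inj_on_subset[OF \<phi>(1) Q(1)] by (simp add: inj_on_def j)
  ultimately have "inj_on j (V1.span Q)" by (rule j.inj_on_span_independent_image)
  with lin span show thesis by (intro that) simp_all
qed

definition scale_pair ::
    "('k::field \<Rightarrow> 'v::ab_group_add \<Rightarrow> 'v) \<Rightarrow> 'k \<Rightarrow> 'v \<times> 'k poly \<Rightarrow> 'v \<times> 'k poly" where
  "scale_pair scale a y = (scale a (fst y), smult a (snd y))"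

lemma vector_space_scale_pair:
  assumes "vector_space scale"
  shows "vector_space (scale_pair scale)"
proof -
  interpret vector_space scale by fact
  show ?thesis
    by unfold_locales (simp_all add: scale_pair_def scale_right_distrib scale_left_distrib
        smult_add_right smult_add_left)
qed

lemma span_scale_pair:
  assumes "vector_space scale"
  shows "module.span (scale_pair scale)
    (range (\<lambda>s::'v::ab_group_add + nat. case s of Inl v \<Rightarrow> (v, 0) | Inr i \<Rightarrow> (0, monom 1 i))) = UNIV"
    (is "module.span _ ?G = _")
proof -
  interpret vector_space scale by fact
  interpret P: vector_space "scale_pair scale" by (rule vector_space_scale_pair) fact
  have G: "(v, 0) \<in> ?G" "(0, monom 1 i) \<in> ?G" for v i
    using rangeI[of "\<lambda>s. case s of Inl v \<Rightarrow> (v, 0) | Inr i \<Rightarrow> (0, monom 1 i)" "Inl v"]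
      rangeI[of "\<lambda>s. case s of Inl v \<Rightarrow> (v, 0) | Inr i \<Rightarrow> (0, monom 1 i)" "Inr i"] by simp_all
  have monom: "scale_pair scale a (0, monom 1 i) = (0, monom a i)" for a i
    by (simp add: scale_pair_def smult_monom)
  have sum: "(0, \<Sum>i\<le>n. monom (c i) i) \<in> P.span ?G" for c and n :: nat
  proof (induction n)
    case (Suc n)
    have "scale_pair scale (c (Suc n)) (0, monom 1 (Suc n)) \<in> P.span ?G"
      by (intro P.span_scale P.span_base G)
    from P.span_add[OF Suc this] show ?case by (simp add: monom)
  next
    case 0
    have "scale_pair scale (c 0) (0, monom 1 0) \<in> P.span ?G"
      by (intro P.span_scale P.span_base G)
    then have "(0, monom (c 0) 0) \<in> P.span ?G" by (simp only: monom)
    then show ?case by simp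
  qed
  have "(v, p) \<in> P.span ?G" for v p
  proof -
    have "(v, 0) + (0, p) \<in> P.span ?G"
      using sum[of "coeff p" "degree p"]
      by (intro P.span_add[OF P.span_base[OF G(1)]]) (simp add: poly_as_sum_of_monoms)
    then show ?thesis by simp
  qed
  then show ?thesis by auto
qed

text \<open>The generators are indexed by \<open>V + \<nat>\<close>, and \<open>V\<close> absorbs the countable summand because it is infinite.\<close>

lemma ex_linear_injection_pair:
  fixes scale :: "'k::field \<Rightarrow> 'v::ab_group_add \<Rightarrow> 'v"
  assumes vs: "vector_space scale" and vsW: "vector_space scaleW"
    and large: "large_for scaleW (UNIV :: 'v set)" and inf: "infinite (UNIV :: 'v set)"
  obtains j where "Vector_Spaces.linear (scale_pair scale) scaleW j" "inj j"
proof -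
  obtain B where B: "\<not> module.dependent scaleW B" "(UNIV :: 'v set) \<lesssim> B"
    using large by (auto simp: large_for_def)
  let ?gen = "\<lambda>s::'v + nat. case s of Inl v \<Rightarrow> (v, 0) | Inr i \<Rightarrow> (0, monom 1 i :: 'k poly)"
  have "(UNIV :: 'v set) <+> (UNIV :: nat set) \<approx> (UNIV :: 'v set)"
    unfolding eqpoll_iff_card_of_ordIso
    by (rule card_of_Plus_infinite1[OF inf iffD1[OF infinite_iff_card_of_nat inf]])
  then have "(UNIV :: ('v + nat) set) \<approx> (UNIV :: 'v set)" by simp
  then have "(UNIV :: ('v + nat) set) \<lesssim> B" using B(2) by (rule lepoll_trans1)
  with image_lepoll have "range ?gen \<lesssim> B" by (rule lepoll_trans)
  then show thesis
    using ex_linear_injection[OF vector_space_scale_pair[OF vs] vsW span_scale_pair[OF vs] B(1)] that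
    by blast
qed

section \<open>Adjoining a root of a linear equation\<close>

text \<open>The carry in the last summand is what makes the action on reduced pairs below associative.\<close>

lemma mult_div_mod_poly:
  fixes g q \<rho> :: "'k::field poly"
  shows "(g * q) div \<rho> = g * (q div \<rho>) + (g * (q mod \<rho>)) div \<rho>"
proof (cases "\<rho> = 0")
  case False
  have "g * q = g * (q mod \<rho>) + (g * (q div \<rho>)) * \<rho>"
    by (metis distrib_left mod_div_mult_eq mult.assoc)
  then show ?thesis using False by (simp add: add.commute)
qed simp

text \<open>The module \<open>(V \<times> K[X]) / K[X](u, -\<rho>)\<close>, in which \<open>(0, 1)\<close> solves \<open>\<rho> x = u\<close>, is represented
  by its reduced pairs: \<open>(v, p)\<close> has the representative \<open>(v + (p div \<rho>) u, p mod \<rho>)\<close>. The conventions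
  \<open>p div 0 = 0\<close> and \<open>p mod 0 = p\<close> make \<open>\<rho> = 0\<close>, \<open>u = 0\<close> the direct sum \<open>V \<times> K[X]\<close>.\<close>

definition root_space :: "'k::field poly \<Rightarrow> ('v \<times> 'k poly) set" where
  "root_space \<rho> = {(v, p). p mod \<rho> = p}"

definition root_act ::
    "('k::field poly \<Rightarrow> 'v::ab_group_add \<Rightarrow> 'v) \<Rightarrow> 'k poly \<Rightarrow> 'v \<Rightarrow> 'k poly \<Rightarrow> 'v \<times> 'k poly \<Rightarrow> 'v \<times> 'k poly"
where
  "root_act sv \<rho> u g y =
     (sv g (fst y) + sv ((g * snd y) div \<rho>) u, (g * snd y) mod \<rho>)"

lemma root_act_closed: "root_act sv \<rho> u g y \<in> root_space \<rho>"
  by (simp add: root_act_def root_space_def)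

lemma reduced_div_eq_0: "p mod \<rho> = p \<Longrightarrow> p div \<rho> = (0 :: 'k::field poly)"
  by (metis add_cancel_left_left div_by_0 div_mult_mod_eq mult_eq_0_iff)

context
  fixes sv :: "'k::field poly \<Rightarrow> 'v::ab_group_add \<Rightarrow> 'v"
  assumes mod_sv: "module sv"
begin

interpretation module sv by (fact mod_sv)

lemma root_act_add_right:
  "root_act sv \<rho> u g (x + y) = root_act sv \<rho> u g x + root_act sv \<rho> u g y"
  by (simp add: root_act_def distrib_left poly_div_add_left poly_mod_add_left algebra_simps)

lemma root_act_add_left:
  "root_act sv \<rho> u (f + g) y = root_act sv \<rho> u f y + root_act sv \<rho> u g y"
  by (simp add: root_act_def distrib_right poly_div_add_left poly_mod_add_left algebra_simps)

lemma root_act_mult: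
  "root_act sv \<rho> u (f * g) y = root_act sv \<rho> u f (root_act sv \<rho> u g y)"
proof -
  have "sv ((f * g * snd y) div \<rho>) u
      = sv f (sv ((g * snd y) div \<rho>) u) + sv ((f * (g * snd y mod \<rho>)) div \<rho>) u"
    using mult_div_mod_poly[of f "g * snd y" \<rho>] by (simp add: scale_left_distrib mult.assoc)
  moreover have "(f * g * snd y) mod \<rho> = (f * (g * snd y mod \<rho>)) mod \<rho>"
    by (simp add: mod_mult_right_eq mult.assoc)
  ultimately show ?thesis by (simp add: root_act_def scale_right_distrib add.assoc)
qed

lemma root_act_const:
  assumes "y \<in> root_space \<rho>"
  shows "root_act sv \<rho> u [:a:] y = (sv [:a:] (fst y), smult a (snd y))"
  using assms reduced_div_eq_0[of "snd y" \<rho>]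
  by (auto simp: root_act_def root_space_def div_smult_left mod_smult_left)

end

text \<open>The action of \<open>X\<close> on reduced pairs is the endomorphism of the extension. On all pairs it is merely
  linear; the identification with the polynomial action needs reduced pairs, as \<open>1\<close> acts by reduction.\<close>

lemma poly_endo_root_act:
  assumes vs: "vector_space scale" and endo: "endomorphism_on scale UNIV \<theta>"
  defines "sv \<equiv> \<lambda>\<rho>. poly_endo scale \<rho> \<theta>"
  shows "endomorphism_on (scale_pair scale) UNIV (root_act sv \<rho> u [:0, 1:])"
    and "y \<in> root_space \<rho> \<Longrightarrow>
      poly_endo (scale_pair scale) g (root_act sv \<rho> u [:0, 1:]) y = root_act sv \<rho> u g y"
proof -
  let ?\<Theta> = "root_act sv \<rho> u [:0, 1:]"
  interpret vector_space scale by fact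
  have mod_sv: "module sv" unfolding sv_def by (rule module_poly_endo[OF vs endo])
  interpret X: module sv by (rule mod_sv)
  note vsP = vector_space_scale_pair[OF vs]
  have scale: "scale a v = sv [:a:] v" for a v by (simp add: sv_def poly_endo_const)
  have "root_act sv \<rho> u g (scale_pair scale a y) = scale_pair scale a (root_act sv \<rho> u g y)" for g a y
    by (simp add: root_act_def scale_pair_def scale X.scale_right_distrib div_smult_left mod_smult_left
        mult.commute)
  then show endoP: "endomorphism_on (scale_pair scale) UNIV ?\<Theta>"
    by (simp add: endomorphism_on_def root_act_add_right[OF mod_sv])
  assume y: "y \<in> root_space \<rho>"
  show "poly_endo (scale_pair scale) g ?\<Theta> y = root_act sv \<rho> u g y"
  proof (induction g)
    case 0
    show ?case by (simp add: poly_endo_0[OF vsP] root_act_def zero_prod_def)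
  next
    case (pCons a g)
    have "pCons a g = [:a:] + [:0, 1:] * g" by simp
    then have "root_act sv \<rho> u (pCons a g) y = root_act sv \<rho> u [:a:] y + ?\<Theta> (root_act sv \<rho> u g y)"
      by (simp only: root_act_add_left[OF mod_sv] root_act_mult[OF mod_sv])
    also have "root_act sv \<rho> u [:a:] y = scale_pair scale a y"
      using root_act_const[OF mod_sv y] by (simp add: scale_pair_def scale)
    finally show ?case by (simp add: poly_endo_pCons[OF vsP endoP] pCons.IH)
  qed
qed

section \<open>Realizing roots in existentially closed models\<close>

definition poly_tm :: "'k::zero poly \<Rightarrow> 'k tm \<Rightarrow> 'k tm" where
  "poly_tm \<rho> t = foldr (\<lambda>i. Add (Smult (coeff \<rho> i) ((Theta ^^ i) t))) [0..<Suc (degree \<rho>)] Zero"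

lemma tm_val_poly_tm: "tm_val scale \<theta> e (poly_tm \<rho> t) = poly_endo scale \<rho> \<theta> (tm_val scale \<theta> e t)"
proof -
  have iter: "tm_val scale \<theta> e ((Theta ^^ i) t) = (\<theta> ^^ i) (tm_val scale \<theta> e t)" for i
    by (induction i) simp_all
  have "tm_val scale \<theta> e (foldr (\<lambda>i. Add (Smult (coeff \<rho> i) ((Theta ^^ i) t))) is Zero)
      = (\<Sum>i\<leftarrow>is. scale (coeff \<rho> i) ((\<theta> ^^ i) (tm_val scale \<theta> e t)))" for "is"
    by (induction "is") (simp_all add: iter)
  then show ?thesis
    by (simp add: poly_tm_def poly_endo_def interv_sum_list_conv_sum_set_nat
        atLeast0LessThan lessThan_Suc_atMost del: upt_Suc)
qed

lemma existentially_closed_realizes: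
  assumes ec: "existentially_closed scaleW C scale UNIV \<theta>"
    and N: "models_T C scaleW N \<eta>" and h: "embedding scale UNIV \<theta> scaleW N \<eta> h"
    and y: "y \<in> N" "poly_endo scaleW \<rho> \<eta> y = h u"
    and F: "finite F" "\<And>\<sigma> w. (\<sigma>, w) \<in> F \<Longrightarrow> poly_endo scaleW \<sigma> \<eta> y \<noteq> h w"
  obtains x where "poly_endo scale \<rho> \<theta> x = u"
    and "\<And>\<sigma> w. (\<sigma>, w) \<in> F \<Longrightarrow> poly_endo scale \<sigma> \<theta> x \<noteq> w"
proof -
  obtain fs where fs: "set fs = F" using finite_list[OF F(1)] by blast
  define \<psi> where "\<psi> = foldr Conj
    (map (\<lambda>i. Neg (Equal (poly_tm (fst (fs ! i)) (Var 0)) (Var (i + 2)))) [0..<length fs])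
    (Equal (poly_tm \<rho> (Var 0)) (Var 1))"
  \<comment> \<open>Variable \<open>0\<close> is the unknown, \<open>1\<close> stands for \<open>u\<close> and \<open>i + 2\<close> for the \<open>i\<close>-th right-hand side.\<close>
  define e where "e i = (if i = 1 then u else snd (fs ! (i - 2)))" for i
  have "quantifier_free (foldr Conj (map (\<lambda>i. Neg (Equal (s i) (t i))) is) (Equal s' t'))" for s t "is" and s' t' :: "'a tm"
    by (induction "is") simp_all
  then have "existential (Exi 0 \<psi>)" unfolding \<psi>_def by (intro existential.intros)
  have foldr_Conj: "sat sc M \<tau> e' (foldr Conj \<phi>s \<phi>) \<longleftrightarrow> (\<forall>\<chi>\<in>set \<phi>s. sat sc M \<tau> e' \<chi>) \<and> sat sc M \<tau> e' \<phi>"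
    for sc :: "'a \<Rightarrow> 'm::ab_group_add \<Rightarrow> 'm" and M \<tau> e' \<phi>s \<phi>
    by (induction \<phi>s) auto
  have sat_\<psi>: "sat sc M \<tau> e' \<psi> \<longleftrightarrow>
      (\<forall>i<length fs. poly_endo sc (fst (fs ! i)) \<tau> (e' 0) \<noteq> e' (i + 2)) \<and> poly_endo sc \<rho> \<tau> (e' 0) = e' 1"
    for sc :: "'a \<Rightarrow> 'm::ab_group_add \<Rightarrow> 'm" and M \<tau> e'
    unfolding \<psi>_def foldr_Conj by (auto simp: tm_val_poly_tm)
  have "poly_endo scaleW (fst (fs ! i)) \<eta> y \<noteq> h (snd (fs ! i))" if "i < length fs" for i
    using F(2)[of "fst (fs ! i)" "snd (fs ! i)"] that fs nth_mem by fastforce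
  then have "sat scaleW N \<eta> ((h \<circ> e)(0 := y)) \<psi>"
    unfolding sat_\<psi> using y(2) by (simp add: e_def)
  then have "sat scaleW N \<eta> (h \<circ> e) (Exi 0 \<psi>)" using y(1) by auto
  then have "sat scale UNIV \<theta> e (Exi 0 \<psi>)"
    using ec N h \<open>existential (Exi 0 \<psi>)\<close> unfolding existentially_closed_def by blast
  then obtain x where "sat scale UNIV \<theta> (e(0 := x)) \<psi>" by auto
  then have x: "poly_endo scale \<rho> \<theta> x = u"
    "\<And>i. i < length fs \<Longrightarrow> poly_endo scale (fst (fs ! i)) \<theta> x \<noteq> snd (fs ! i)"
    unfolding sat_\<psi> by (simp_all add: e_def)
  have "poly_endo scale \<sigma> \<theta> x \<noteq> w" if "(\<sigma>, w) \<in> F" for \<sigma> w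
    using that x(2) fs by (metis fst_conv in_set_conv_nth snd_conv)
  with x(1) show thesis by (rule that)
qed

text \<open>Once the module with the adjoined root is known to be a model, it is moved into the ambient
  space by a linear injection, and existential closedness is applied to the formula stating that
  \<open>\<rho> x = u\<close> has a solution with \<open>\<sigma> x \<noteq> w\<close> for all \<open>(\<sigma>, w) \<in> F\<close>.\<close>

lemma root_realized:
  fixes C :: "'k::field kconf"
    and scale :: "'k \<Rightarrow> 'v::ab_group_add \<Rightarrow> 'v" and scaleW :: "'k \<Rightarrow> 'w::ab_group_add \<Rightarrow> 'w"
  assumes model: "models_T C scale UNIV \<theta>" and vsW: "vector_space scaleW"
    and large: "large_for scaleW (UNIV :: 'v set)"
    and ec: "existentially_closed scaleW C scale UNIV \<theta>"
    and sv_def: "sv = (\<lambda>\<rho>. poly_endo scale \<rho> \<theta>)"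
    and \<rho>: "\<not> \<rho> dvd 1" "\<rho> = 0 \<Longrightarrow> u = 0"
    and annihilated: "\<And>y. algebraic C \<Longrightarrow> y \<in> root_space \<rho> \<Longrightarrow> root_act sv \<rho> u (MiPo C) y = 0"
    and Ker_stable: "\<And>f y. \<lbrakk>transcendental C; f \<in> monic_irreducibles; fst C f < \<infinity>; y \<in> root_space \<rho>;
        root_act sv \<rho> u (f ^ (the_enat (fst C f) + 1)) y = 0\<rbrakk> \<Longrightarrow>
        root_act sv \<rho> u (f ^ the_enat (fst C f)) y = 0"
    and F: "finite F" "\<And>\<sigma> w. (\<sigma>, w) \<in> F \<Longrightarrow> (sv (\<sigma> div \<rho>) u, \<sigma> mod \<rho>) \<noteq> (w, 0)"
  shows "\<exists>x. sv \<rho> x = u \<and> (\<forall>(\<sigma>, w)\<in>F. sv \<sigma> x \<noteq> w)"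
proof -
  have vs: "vector_space scale" and inf: "infinite (UNIV :: 'v set)"
    and endo: "endomorphism_on scale UNIV \<theta>"
    using model by (auto simp: models_T_def C_endomorphism_def)
  have mod_sv: "module sv" unfolding sv_def by (rule module_poly_endo[OF vs endo])
  interpret X: module sv by (rule mod_sv)
  interpret W: vector_space scaleW by (rule vsW)
  interpret P: vector_space "scale_pair scale" by (rule vector_space_scale_pair[OF vs])
  let ?\<Theta> = "root_act sv \<rho> u [:0, 1:]"
  note endoP = poly_endo_root_act(1)[OF vs endo, of \<rho> u, folded sv_def]
  note actP = poly_endo_root_act(2)[OF vs endo, of _ \<rho> _ u, folded sv_def]
  obtain j where j_lin: "Vector_Spaces.linear (scale_pair scale) scaleW j" and j_inj: "inj j"
    by (rule ex_linear_injection_pair[OF vs vsW large inf])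
  interpret j: Vector_Spaces.linear "scale_pair scale" scaleW j by (rule j_lin)
  define N where "N = j ` root_space \<rho>"
  define \<eta> where "\<eta> y = j (?\<Theta> (inv j y))" for y
  define h where "h v = j (v, 0)" for v
  have j_eq: "j x = j y \<longleftrightarrow> x = y" for x y using j_inj by (simp add: inj_eq)
  have \<eta>j: "\<eta> (j y) = j (?\<Theta> y)" for y using j_inj by (simp add: \<eta>_def)
  have act: "poly_endo scaleW g \<eta> (j y) = j (root_act sv \<rho> u g y)" if "y \<in> root_space \<rho>" for g y
    unfolding actP[OF that, symmetric]
    by (rule poly_endo_hom) (simp_all add: j.add j.scale \<eta>j)
  have sub: "P.subspace (root_space \<rho>)"
    by (rule P.subspaceI)
      (auto simp: root_space_def scale_pair_def zero_prod_def poly_mod_add_left mod_smult_left)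
  have base: "(v, 0) \<in> root_space \<rho>" for v :: 'v by (simp add: root_space_def)
  have zero: "0 = j 0" by (simp add: j.zero)
  have model_N: "models_T C scaleW N \<eta>"
    unfolding models_T_def C_endomorphism_def
  proof (intro conjI impI ballI)
    show "W.subspace N" unfolding N_def by (rule j.subspace_image[OF sub])
    have "h ` UNIV \<subseteq> N" using base by (auto simp: h_def N_def)
    moreover have "infinite (h ` UNIV)"
      using inf by (subst finite_image_iff) (auto simp: h_def inj_on_def j_eq)
    ultimately show "infinite N" using finite_subset by blast
    show "endomorphism_on scaleW N \<eta>"
      using endoP
      by (auto simp: endomorphism_on_def N_def \<eta>j simp flip: j.add j.scale
          intro!: imageI root_act_closed)
    fix y assume "algebraic C" and "y \<in> N"
    then obtain y' where "y = j y'" "y' \<in> root_space \<rho>" by (auto simp: N_def)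
    then show "poly_endo scaleW (MiPo C) \<eta> y = 0"
      using annihilated[OF \<open>algebraic C\<close>] by (simp add: act j.zero)
  next
    fix f assume f: "transcendental C" "f \<in> monic_irreducibles" "fst C f < \<infinity>"
    let ?n = "the_enat (fst C f)"
    have "root_act sv \<rho> u (f ^ ?n) y = 0 \<longleftrightarrow> root_act sv \<rho> u (f ^ (?n + 1)) y = 0"
      if y: "y \<in> root_space \<rho>" for y
    proof
      assume "root_act sv \<rho> u (f ^ ?n) y = 0"
      then have "root_act sv \<rho> u (f * f ^ ?n) y = 0"
        unfolding root_act_mult[OF mod_sv] by (simp add: root_act_def zero_prod_def)
      then show "root_act sv \<rho> u (f ^ (?n + 1)) y = 0" by simp
    qed (rule Ker_stable[OF f y])
    then show "Ker_on scaleW N \<eta> (f ^ ?n) = Ker_on scaleW N \<eta> (f ^ (?n + 1))"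
      by (auto simp: Ker_on_def N_def act zero j_eq simp del: j.zero)
  qed (rule vsW)
  have emb: "embedding scale UNIV \<theta> scaleW N \<eta> h"
    unfolding embedding_def
  proof (intro conjI ballI allI)
    show "inj h" by (simp add: h_def inj_on_def j_eq)
    show "range h \<subseteq> N" using base by (auto simp: h_def N_def)
    show "h 0 = 0" by (simp add: h_def j.zero flip: zero_prod_def)
    show "h (x + y) = h x + h y" for x y by (simp add: h_def flip: j.add)
    show "h (scale a x) = scaleW a (h x)" for a x
      by (simp add: h_def scale_pair_def flip: j.scale)
    have "?\<Theta> (x, 0) = (\<theta> x, 0)" for x
      by (simp add: root_act_def sv_def poly_endo_X[OF vs] poly_endo_0[OF vs])
    then show "h (\<theta> x) = \<eta> (h x)" for x by (simp add: h_def \<eta>j)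
  qed
  have one: "(0, 1) \<in> root_space \<rho>"
  proof (cases "\<rho> = 0")
    case False
    then have "degree \<rho> \<noteq> 0" using \<rho>(1) by (simp add: is_unit_iff_degree)
    then show ?thesis by (simp add: root_space_def mod_poly_less)
  qed (simp add: root_space_def)
  have act_one: "root_act sv \<rho> u g (0, 1) = (sv (g div \<rho>) u, g mod \<rho>)" for g
    by (simp add: root_act_def)
  have "poly_endo scaleW \<rho> \<eta> (j (0, 1)) = h u"
    unfolding act[OF one] act_one using \<rho>(2) by (cases "\<rho> = 0") (simp_all add: h_def)
  moreover have "poly_endo scaleW \<sigma> \<eta> (j (0, 1)) \<noteq> h w" if "(\<sigma>, w) \<in> F" for \<sigma> w
    using F(2)[OF that] by (simp add: act[OF one] act_one h_def j_eq)
  moreover have "j (0, 1) \<in> N" unfolding N_def by (rule imageI[OF one])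
  ultimately obtain x where "poly_endo scale \<rho> \<theta> x = u"
    "\<And>\<sigma> w. (\<sigma>, w) \<in> F \<Longrightarrow> poly_endo scale \<sigma> \<theta> x \<noteq> w"
    using existentially_closed_realizes[OF ec model_N emb _ _ F(1)] by blast
  then show ?thesis unfolding sv_def by blast
qed

text \<open>If \<open>\<rho>\<close> is zero or prime to \<open>f\<close>, then \<open>f\<close> acts injectively on \<open>K[X] / \<rho>\<close>, so the kernels of
  powers of \<open>f\<close> do not grow beyond \<open>V\<close>.\<close>

lemma root_act_Ker_stable_coprime:
  assumes mod_sv: "module sv" and f: "f \<in> monic_irreducibles"
    and \<rho>: "\<rho> = 0 \<or> (\<exists>g\<in>monic_irreducibles. g \<noteq> f \<and> (\<exists>k. \<rho> = g ^ k))"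
    and V: "\<forall>v. sv (f ^ (n + 1)) v = 0 \<longrightarrow> sv (f ^ n) v = 0"
    and y: "y \<in> root_space \<rho>" "root_act sv \<rho> u (f ^ (n + 1)) y = 0"
  shows "root_act sv \<rho> u (f ^ n) y = 0"
proof -
  interpret module sv by fact
  have mod0: "(f ^ (n + 1) * snd y) mod \<rho> = 0" and reduced: "snd y mod \<rho> = snd y"
    using y by (auto simp: root_act_def root_space_def zero_prod_def)
  have "snd y = 0"
    using \<rho>
  proof
    assume "\<rho> = 0"
    then show ?thesis using mod0 monic_irreducibleD(2)[OF f] by simp
  next
    assume "\<exists>g\<in>monic_irreducibles. g \<noteq> f \<and> (\<exists>k. \<rho> = g ^ k)"
    then obtain g k where g: "g \<in> monic_irreducibles" "g \<noteq> f" "\<rho> = g ^ k" by blast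
    have irr: "irreducible g" by (rule monic_irreducibleD(1)[OF g(1)])
    have "\<not> g dvd f ^ (n + 1)"
      using prime_elem_dvd_power[OF irreducible_imp_prime_elem[OF irr]]
        monic_irreducible_dvd_imp_eq[OF g(1) f] g(2) by blast
    moreover have "g ^ k dvd f ^ (n + 1) * snd y" using mod0 g(3) by (simp add: mod_eq_0_iff_dvd)
    ultimately have "g ^ k dvd snd y" using irreducible_power_dvd_mult[OF irr] by blast
    then show ?thesis using reduced g(3) by (metis mod_eq_0_iff_dvd)
  qed
  then show ?thesis using y(2) V by (simp add: root_act_def zero_prod_def)
qed

text \<open>For each condition the kernel conditions at \<open>g \<noteq> f\<close> come from coprimality. At \<open>g = f\<close> they use
  what is special about \<open>u\<close>: that \<open>f ^ (C(f) - 1) u = 0\<close> for fibres, and that \<open>u = f ^ C(f) v\<close> is not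
  yet in \<open>f ^ (C(f) + 1) V\<close> for images. In the algebraic case no extension is needed for images: a
  Bezout relation with the minimal polynomial already solves the equation in \<open>V\<close>.\<close>

proposition existentially_closed_imp_C_complete:
  fixes C :: "'k::field kconf"
    and scale :: "'k \<Rightarrow> 'v::ab_group_add \<Rightarrow> 'v" and scaleW :: "'k \<Rightarrow> 'w::ab_group_add \<Rightarrow> 'w"
  assumes C: "kernel_configuration C" and model: "models_T C scale UNIV \<theta>"
    and vsW: "vector_space scaleW" and large: "large_for scaleW (UNIV :: 'v set)"
    and ec: "existentially_closed scaleW C scale UNIV \<theta>"
  shows "C_complete C scale UNIV \<theta>"
proof -
  define sv where "sv = (\<lambda>\<rho>. poly_endo scale \<rho> \<theta>)"
  have vs: "vector_space scale" and C_endo: "C_endomorphism C scale UNIV \<theta>"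
    and endo: "endomorphism_on scale UNIV \<theta>"
    using model by (auto simp: models_T_def C_endomorphism_def)
  have mod_sv: "module sv" unfolding sv_def by (rule module_poly_endo[OF vs endo])
  interpret module sv by (rule mod_sv)
  let ?n = "\<lambda>f. the_enat (fst C f)"
  have MiPo: "sv (MiPo C) v = 0" if "algebraic C" for v
    using C_endo that by (simp add: C_endomorphism_def sv_def)
  have Ker: "\<forall>v. sv (f ^ (?n f + 1)) v = 0 \<longrightarrow> sv (f ^ ?n f) v = 0"
    if "transcendental C" "f \<in> monic_irreducibles" "fst C f < \<infinity>" for f
  proof -
    have "Ker_on scale UNIV \<theta> (f ^ ?n f) = Ker_on scale UNIV \<theta> (f ^ (?n f + 1))"
      using C_endo that by (simp add: C_endomorphism_def)
    then show ?thesis unfolding Ker_on_def sv_def by blast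
  qed
  note realized = root_realized[OF model vsW large ec sv_def]
  note coprime = root_act_Ker_stable_coprime[OF mod_sv]
  have not_transcendental: "\<not> transcendental C" if "algebraic C"
    using that by (simp add: algebraic_def transcendental_def)

  have Im: "\<exists>z. sv (f ^ (?n f + 1)) z = sv (f ^ ?n f) v"
    if f: "f \<in> monic_irreducibles" "fst C f < \<infinity>" for f v
  proof (cases "algebraic C")
    case True
    obtain m where m: "MiPo C = f ^ ?n f * m" "\<not> f dvd m" using MiPo_split[OF C True f(1)] .
    obtain a b where "a * f + b * m = 1"
      using irreducible_bezout[OF monic_irreducibleD(1)[OF f(1)] m(2)] .
    then have "f ^ ?n f = (a * f + b * m) * f ^ ?n f" by simp
    also have "\<dots> = f ^ (?n f + 1) * a + b * MiPo C" by (simp add: m(1) algebra_simps)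
    finally have "sv (f ^ ?n f) v = sv (f ^ (?n f + 1)) (sv a v) + sv b (sv (MiPo C) v)"
      by (simp add: scale_left_distrib del: power_Suc)
    then show ?thesis using MiPo[OF True] by (intro exI[of _ "sv a v"]) simp
  next
    case False
    show ?thesis
    proof (rule ccontr)
      assume not_Im: "\<nexists>z. sv (f ^ (?n f + 1)) z = sv (f ^ ?n f) v"
      let ?\<rho> = "f ^ (?n f + 1)" and ?u = "sv (f ^ ?n f) v"
      have irr: "irreducible f" and f0: "f \<noteq> 0" and nonunit: "\<not> f dvd 1"
        using monic_irreducibleD[OF f(1)] by auto
      have stable: "root_act sv ?\<rho> ?u (g ^ ?n g) y = 0"
        if g: "transcendental C" "g \<in> monic_irreducibles" "fst C g < \<infinity>"
          and y: "y \<in> root_space ?\<rho>" "root_act sv ?\<rho> ?u (g ^ (?n g + 1)) y = 0" for g y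
      proof (cases "g = f")
        case False
        have "?\<rho> = 0 \<or> (\<exists>h\<in>monic_irreducibles. h \<noteq> g \<and> (\<exists>k. ?\<rho> = h ^ k))"
          using False f(1) by (intro disjI2 bexI[of _ f] conjI exI[of _ "?n f + 1"]) auto
        then show ?thesis by (rule coprime[OF g(2) _ Ker[OF g] y])
      next
        case True
        obtain w p where wp: "y = (w, p)" by fastforce
        have eq: "sv (f ^ (?n f + 1)) w + sv p ?u = 0"
          using y(2) f0 by (simp add: True wp root_act_def zero_prod_def)
        \<comment> \<open>Otherwise \<open>p\<close> is invertible modulo \<open>f\<close>, and the relation would put \<open>f ^ C(f) v\<close> into
            \<open>f ^ (C(f) + 1) V\<close>.\<close>
        have "f dvd p"
        proof (rule ccontr)
          assume "\<not> f dvd p"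
          then obtain a b where ab: "a * f + b * p = 1" using irreducible_bezout[OF irr] by blast
          have pu: "sv p ?u = sv (f ^ (?n f + 1)) (- w)"
            using eq by (simp add: eq_neg_iff_add_eq_0 add.commute)
          have "?u = sv (a * f + b * p) ?u" by (simp add: ab)
          also have "\<dots> = sv (f ^ (?n f + 1)) (sv a v) + sv b (sv p ?u)"
            by (simp add: scale_left_distrib distrib_left mult_ac)
          also have "\<dots> = sv (f ^ (?n f + 1)) (sv a v - sv b w)"
            unfolding pu by (simp add: scale_right_diff_distrib mult_ac)
          finally show False using not_Im by metis
        qed
        then obtain p' where p': "p = f * p'" by blast
        have "sv (f ^ (?n f + 1)) (w + sv p' v) = 0"
          using eq by (simp add: p' scale_right_distrib mult_ac)
        then have "sv (f ^ ?n f) (w + sv p' v) = 0" using Ker g True by blast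
        moreover have "f ^ ?n f * p = p' * ?\<rho>" by (simp add: p' mult_ac)
        ultimately show ?thesis
          using f0 by (simp add: True wp root_act_def zero_prod_def scale_right_distrib mult_ac)
      qed
      have "\<exists>x. sv ?\<rho> x = ?u \<and> (\<forall>(\<sigma>, w)\<in>{}. sv \<sigma> x \<noteq> w)"
      proof (rule realized)
        show "\<not> ?\<rho> dvd 1" using nonunit by (metis dvd_trans dvd_triv_left power_Suc Suc_eq_plus1)
        show "?u = 0" if "?\<rho> = 0" using that f0 by simp
        show "root_act sv ?\<rho> ?u (MiPo C) y = 0" if "algebraic C" for y
          using that False by contradiction
      qed (fact stable | simp)+
      with not_Im show False by blast
    qed
  qed

  have fibre: "infinite {x. sv f x = u}"
    if f: "f \<in> monic_irreducibles"
      and u: "fst C f < \<infinity> \<Longrightarrow> 0 < fst C f \<and> sv (f ^ (?n f - 1)) u = 0" for f u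
  proof
    assume fin: "finite {x. sv f x = u}"
    have irr: "irreducible f" and f0: "f \<noteq> 0" and nonunit: "\<not> f dvd 1" and deg: "0 < degree f"
      using monic_irreducibleD[OF f] by auto
    have fn: "f ^ ?n f = f * f ^ (?n f - 1)" if "fst C f < \<infinity>"
    proof -
      have "?n f \<noteq> 0" using u[OF that] that by (cases "fst C f") (auto simp: zero_enat_def)
      then show ?thesis by (simp add: power_eq_if)
    qed
    have killed: "sv (q * f ^ (?n f - 1)) u = 0" if "fst C f < \<infinity>" for q
      using u[OF that] by (metis scale_scale scale_zero_right)
    have annihilated: "root_act sv f u (MiPo C) y = 0" if alg: "algebraic C" and y: "y \<in> root_space f" for y
    proof -
      have finC: "fst C f < \<infinity>" by (rule algebraic_imp_finite(2)[OF C alg f])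
      obtain m where m: "MiPo C = f ^ ?n f * m" using MiPo_split[OF C alg f] by blast
      have "MiPo C * snd y = (m * snd y * f ^ (?n f - 1)) * f"
        by (simp add: m fn[OF finC] mult_ac)
      then have "sv ((MiPo C * snd y) div f) u = 0" "(MiPo C * snd y) mod f = 0"
        using f0 killed[OF finC] by (simp_all only: nonzero_mult_div_cancel_right mod_mult_self2_is_0 not_False_eq_True)
      then show ?thesis using MiPo[OF alg] by (simp add: root_act_def zero_prod_def)
    qed
    have stable: "root_act sv f u (g ^ ?n g) y = 0"
      if g: "transcendental C" "g \<in> monic_irreducibles" "fst C g < \<infinity>"
        and y: "y \<in> root_space f" "root_act sv f u (g ^ (?n g + 1)) y = 0" for g y
    proof (cases "g = f")
      case False
      have "f = 0 \<or> (\<exists>h\<in>monic_irreducibles. h \<noteq> g \<and> (\<exists>k. f = h ^ k))"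
        using False f by (intro disjI2 bexI[of _ f] conjI exI[of _ 1]) auto
      then show ?thesis by (rule coprime[OF g(2) _ Ker[OF g] y])
    next
      case True
      with g have finC: "fst C f < \<infinity>" by simp
      have "f ^ (?n f + 1) * snd y = (f * snd y * f ^ (?n f - 1)) * f"
        by (simp add: fn[OF finC] mult_ac)
      then have "sv ((f ^ (?n f + 1) * snd y) div f) u = 0"
        using f0 killed[OF finC] by (simp only: nonzero_mult_div_cancel_right not_False_eq_True)
      then have "sv (f ^ (?n f + 1)) (fst y) = 0"
        using y(2) by (simp add: True root_act_def zero_prod_def)
      then have "sv (f ^ ?n f) (fst y) = 0" using Ker g True by blast
      moreover have "f ^ ?n f * snd y = (snd y * f ^ (?n f - 1)) * f"
        by (simp add: fn[OF finC] mult_ac)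
      then have "sv ((f ^ ?n f * snd y) div f) u = 0" "(f ^ ?n f * snd y) mod f = 0"
        using f0 killed[OF finC] by (simp_all only: nonzero_mult_div_cancel_right mod_mult_self2_is_0 not_False_eq_True)
      ultimately show ?thesis by (simp add: True root_act_def zero_prod_def)
    qed
    have avoid: "(sv (\<sigma> div f) u, \<sigma> mod f) \<noteq> (w, 0)" if "(\<sigma>, w) \<in> Pair 1 ` {x. sv f x = u}" for \<sigma> w
      using that nonunit by (auto simp: mod_eq_0_iff_dvd)
    \<comment> \<open>If the fibre were finite, the inequations \<open>1 x \<noteq> w\<close> for all its elements \<open>w\<close> would be a finite set.\<close>
    have "\<exists>x. sv f x = u \<and> (\<forall>(\<sigma>, w)\<in>Pair 1 ` {x. sv f x = u}. sv \<sigma> x \<noteq> w)"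
    proof (rule realized)
      show "u = 0" if "f = 0" using that f0 by contradiction
      show "finite (Pair (1 :: 'k poly) ` {x. sv f x = u})" using fin by simp
    qed (fact nonunit annihilated stable avoid)+
    then show False by auto
  qed

  have generic: "\<exists>x. \<forall>(\<rho>, u)\<in>F. sv \<rho> x \<noteq> u"
    if "transcendental C" and F: "finite F" "F \<subseteq> {(\<rho>, u). \<rho> \<noteq> 0}" for F
  proof -
    have "\<exists>x. sv 0 x = 0 \<and> (\<forall>(\<sigma>, w)\<in>F. sv \<sigma> x \<noteq> w)"
    proof (rule realized)
      show "root_act sv 0 0 (MiPo C) y = 0" if "algebraic C" for y
        using that not_transcendental \<open>transcendental C\<close> by blast
      show "root_act sv 0 0 (f ^ ?n f) y = 0"
        if f: "transcendental C" "f \<in> monic_irreducibles" "fst C f < \<infinity>"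
          and y: "y \<in> root_space 0" "root_act sv 0 0 (f ^ (?n f + 1)) y = 0" for f y
        by (rule coprime[OF f(2) _ Ker[OF f] y]) simp
      show "finite F" by (rule F(1))
      show "(sv (\<sigma> div 0) 0, \<sigma> mod 0) \<noteq> (w, 0)" if "(\<sigma>, w) \<in> F" for \<sigma> w
        using F(2) that by auto
    qed simp_all
    then show ?thesis by blast
  qed

  show ?thesis
    unfolding C_complete_def
  proof (intro conjI ballI allI impI)
    show "C_endomorphism C scale UNIV \<theta>" by (rule C_endo)
  next
    fix f :: "'k poly" assume f: "f \<in> monic_irreducibles" "fst C f < \<infinity>"
    have range_sv: "Im_on scale UNIV \<theta> g = range (sv g)" for g by (simp add: Im_on_def sv_def)
    show "Im_on scale UNIV \<theta> (f ^ ?n f) = Im_on scale UNIV \<theta> (f ^ (?n f + 1))"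
      unfolding range_sv
    proof (intro equalityI image_subsetI)
      fix v
      obtain z where "sv (f ^ (?n f + 1)) z = sv (f ^ ?n f) v" using Im[OF f] by blast
      from this[symmetric] show "sv (f ^ ?n f) v \<in> range (sv (f ^ (?n f + 1)))" by (rule range_eqI)
      have "sv (f ^ (?n f + 1)) v = sv (f ^ ?n f) (sv f v)" by (simp add: mult.commute)
      then show "sv (f ^ (?n f + 1)) v \<in> range (sv (f ^ ?n f))" by (rule range_eqI)
    qed
  next
    fix f :: "'k poly" and u
    assume "f \<in> monic_irreducibles" "0 < fst C f \<and> fst C f < \<infinity>"
      "u \<in> Ker_on scale UNIV \<theta> (f ^ (?n f - 1))"
    then show "infinite {x \<in> UNIV. poly_endo scale f \<theta> x = u}"
      using fibre[of f u] by (simp add: Ker_on_def sv_def)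
  next
    fix f :: "'k poly" and u
    assume "f \<in> monic_irreducibles" "fst C f = \<infinity>"
    then show "infinite {x \<in> UNIV. poly_endo scale f \<theta> x = u}"
      using fibre[of f u] by (simp add: sv_def)
  next
    fix F :: "('k poly \<times> 'v) set"
    assume "transcendental C" "finite F \<and> F \<subseteq> {(\<rho>, u). \<rho> \<noteq> 0 \<and> u \<in> UNIV}"
    then show "\<exists>x\<in>UNIV. \<forall>(\<rho>, u)\<in>F. poly_endo scale \<rho> \<theta> x \<noteq> u"
      using generic[of F] by (simp add: sv_def)
  qed
qed

theorem theorem4p3:
  fixes C :: "'k::field kconf"
    and scale :: "'k \<Rightarrow> 'v::ab_group_add \<Rightarrow> 'v"
    and \<theta> :: "'v \<Rightarrow> 'v"
    and scaleW :: "'k \<Rightarrow> 'w::ab_group_add \<Rightarrow> 'w"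
  assumes "kernel_configuration C"
    and "models_T C scale UNIV \<theta>"
    and "vector_space scaleW" and "large_for scaleW (UNIV :: 'v set)"
  shows "existentially_closed scaleW C scale UNIV \<theta> \<longleftrightarrow> C_complete C scale UNIV \<theta>"
proof
  show "C_complete C scale UNIV \<theta>" if "existentially_closed scaleW C scale UNIV \<theta>"
    by (rule existentially_closed_imp_C_complete[OF assms that])
next
  have "vector_space scale" using assms(2) by (simp add: models_T_def)
  then show "existentially_closed scaleW C scale UNIV \<theta>" if "C_complete C scale UNIV \<theta>"
    by (rule C_complete_imp_existentially_closed[OF assms(1) _ that])
qed

end
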